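(* Let $T>0$, let $H:\mathbb{R}^N\times\mathbb{R}^N\to\mathbb{R}$ satisfy (H1), (H3), (H4), and (H2) with $C_0=0$ (listed in the context), let $S_T^+$ be the forward viscosity operator associated with $H$, and let $u_T\in\mathrm{Lip}_0(\mathbb{R}^N)$. Then there exists a function $u_0^*\in\mathrm{Lip}_0(\mathbb{R}^N)$ which solves the optimization problem $$\underset{u_0\in\mathrm{Lip}_0(\mathbb{R}^N)}{\text{minimize}}\ \mathcal{J}_T(u_0):=\|S_T^+u_0-u_T\|^2_{L^2(\mathbb{R}^N)}.$$
   Context: $\mathrm{Lip}_0(\mathbb{R}^N)$ is the space of Lipschitz functions $\mathbb{R}^N\to\mathbb{R}$ with compact support. Hypotheses on $H=H(x,p)$: (H1) $H\in C^2(\mathbb{R}^{2N})$ and there is $c_0>0$ with $c_0I_N\le H_{pp}(x,p)$ for all $x,p$; (H2) with $C_0=0$: $H(x,p)\ge0$ for all $x,p$ and $H(x,0)\le0$ for all $x$; (H3) there is $C_{\mathrm{Lip}}>0$ with $|H_x(x,p)|\le C_{\mathrm{Lip}}$ for all $x,p$; (H4) for every $R>0$ there is $C_R>0$ with $|H_p(x,p)|\le C_R$ for all $x$ and all $|p|\le R$. With $H^*(x,q)=\max_p\{p\cdot q-H(x,p)\}$, the forward viscosity operator is $$S_T^+u_0(x)=\inf_{\xi\in W^{1,1}((0,T);\mathbb{R}^N),\ \xi(T)=x}\Big\{\int_0^TH^*(\xi(s),\dot\xi(s))\,ds+u_0(\xi(0))\Big\},$$ i.e. the value at time $T$ of the unique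 viscosity solution of $\partial_tu+H(x,\nabla_xu)=0$, $u(0,\cdot)=u_0$. *)

theory Defs
  imports "HOL-Analysis.Analysis"
begin

text \<open>Twice continuously Frechet differentiable on the whole space.\<close>

definition C2 :: "('a::euclidean_space \<Rightarrow> real) \<Rightarrow> bool" where
  "C2 f \<longleftrightarrow> (\<exists>(D :: 'a \<Rightarrow> 'a \<Rightarrow>\<^sub>L real) (D2 :: 'a \<Rightarrow> 'a \<Rightarrow>\<^sub>L ('a \<Rightarrow>\<^sub>L real)).
     (\<forall>z. (f has_derivative blinfun_apply (D z)) (at z)) \<and>
     (\<forall>z. (D has_derivative blinfun_apply (D2 z)) (at z)) \<and>
     continuous_on UNIV D2)"

definition grad :: "('a::real_inner \<Rightarrow> real) \<Rightarrow> 'a \<Rightarrow> 'a" where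
  "grad f x = (THE D. GDERIV f x :> D)"

definition H_x :: "(real^'n \<Rightarrow> real^'n \<Rightarrow> real) \<Rightarrow> real^'n \<Rightarrow> real^'n \<Rightarrow> real^'n" where
  "H_x H x p = grad (\<lambda>y. H y p) x"

definition H_p :: "(real^'n \<Rightarrow> real^'n \<Rightarrow> real) \<Rightarrow> real^'n \<Rightarrow> real^'n \<Rightarrow> real^'n" where
  "H_p H x p = grad (\<lambda>q. H x q) p"

definition H_pp :: "(real^'n \<Rightarrow> real^'n \<Rightarrow> real) \<Rightarrow> real^'n \<Rightarrow> real^'n \<Rightarrow> real^'n^'n" where
  "H_pp H x p = jacobian (\<lambda>q. H_p H x q) (at p)"

text \<open>The order on symmetric matrices.\<close>

definition loewner_le :: "real^'n^'n \<Rightarrow> real^'n^'n \<Rightarrow> bool" where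
  "loewner_le A B \<longleftrightarrow> (\<forall>v. v \<bullet> (A *v v) \<le> v \<bullet> (B *v v))"

text \<open>For the uniformly convex Hamiltonians considered here the supremum is finite and attained,
  hence a maximum.\<close>

definition legendre :: "(real^'n \<Rightarrow> real^'n \<Rightarrow> real) \<Rightarrow> real^'n \<Rightarrow> real^'n \<Rightarrow> real" where
  "legendre H x q = (SUP p. p \<bullet> q - H x p)"

definition Lip0 :: "(real^'n \<Rightarrow> real) set" where
  "Lip0 = {u. (\<exists>L. L-lipschitz_on UNIV u) \<and> compact (closure {x. u x \<noteq> 0})}"

text \<open>Test functions of class \<open>C\<^sup>1\<close> with compact support in the open interval
  \<open>(0,T)\<close>, extended by zero to the real line; \<open>\<phi>'\<close> is the derivative of \<open>\<phi>\<close>.\<close>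

definition test_fun :: "real \<Rightarrow> (real \<Rightarrow> real) \<Rightarrow> (real \<Rightarrow> real) \<Rightarrow> bool" where
  "test_fun T \<phi> \<phi>' \<longleftrightarrow>
     (\<forall>t. (\<phi> has_real_derivative \<phi>' t) (at t)) \<and> continuous_on UNIV \<phi>' \<and>
     compact (closure {t. \<phi> t \<noteq> 0}) \<and> closure {t. \<phi> t \<noteq> 0} \<subseteq> {0<..<T}"

text \<open>\<open>W11 T \<xi> v\<close> says that \<open>\<xi>\<close> is an element of \<open>W\<^sup>1\<^sup>,\<^sup>1((0,T))\<close> with weak derivative \<open>v\<close>.
  Elements of this space have a unique representative that is continuous on \<open>[0,T]\<close>; this is the
  one used, so that the boundary values \<open>\<xi> 0\<close> and \<open>\<xi> T\<close> make sense.  (Integrability of \<open>\<xi>\<close> itself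
  then is automatic.)\<close>

definition W11 :: "real \<Rightarrow> (real \<Rightarrow> real^'n) \<Rightarrow> (real \<Rightarrow> real^'n) \<Rightarrow> bool" where
  "W11 T \<xi> v \<longleftrightarrow> continuous_on {0..T} \<xi> \<and> set_integrable lborel {0<..<T} v \<and>
     (\<forall>\<phi> \<phi>'. test_fun T \<phi> \<phi>' \<longrightarrow>
        (LINT t:{0<..<T}|lborel. \<phi>' t *\<^sub>R \<xi> t) = - (LINT t:{0<..<T}|lborel. \<phi> t *\<^sub>R v t))"

text \<open>The forward viscosity operator.  Since \<open>H x 0 \<le> 0\<close> the Lagrangian \<open>legendre H\<close> is
  nonnegative, so its integral along a curve is either finite or plus infinity.  Curves of the
  second kind do not affect the infimum and are left out, which keeps the infimum real-valued;
  the remaining set is nonempty (it contains constant curves) and, for bounded \<open>u0\<close>, bounded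
  below.\<close>

definition S_plus ::
    "(real^'n \<Rightarrow> real^'n \<Rightarrow> real) \<Rightarrow> real \<Rightarrow> (real^'n \<Rightarrow> real) \<Rightarrow> real^'n \<Rightarrow> real" where
  "S_plus H T u0 x =
     Inf {(LINT s:{0<..<T}|lborel. legendre H (\<xi> s) (v s)) + u0 (\<xi> 0) | \<xi> v.
            W11 T \<xi> v \<and> \<xi> T = x \<and> set_integrable lborel {0<..<T} (\<lambda>s. legendre H (\<xi> s) (v s))}"

text \<open>The squared \<open>L\<^sup>2\<close> norm, with value plus infinity for functions that are not square integrable.\<close>

definition L2_norm_sq :: "(real^'n \<Rightarrow> real) \<Rightarrow> ennreal" where
  "L2_norm_sq f = (\<integral>\<^sup>+ x. ennreal ((f x)\<^sup>2) \<partial>lborel)"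

definition J_T ::
    "(real^'n \<Rightarrow> real^'n \<Rightarrow> real) \<Rightarrow> real \<Rightarrow> (real^'n \<Rightarrow> real) \<Rightarrow> (real^'n \<Rightarrow> real) \<Rightarrow> ennreal" where
  "J_T H T uT u0 = L2_norm_sq (\<lambda>x. S_plus H T u0 x - uT x)"

end

theory Submission
  imports Defs "HOL-Complex_Analysis.Great_Picard"
begin

text \<open>The forward operator \<open>S\<close> is the inf-convolution with the relation
  that holds of \<open>y\<close>, \<open>x\<close>, \<open>a\<close> if some curve leads from \<open>y\<close> to \<open>x\<close> at action \<open>a\<close>. Perturbing a curve near one of its ends by
  \<open>h\<close> and by \<open>-h\<close> changes the sum of the two actions by at most \<open>K |h|\<^sup>3\<^sup>/\<^sup>2\<close>, because \<open>H\<close> is uniformly convex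
  in the momentum and Lipschitz in the position. Hence all values of \<open>S\<close> are semiconcave with this
  modulus, with \<open>K\<close> independent of the initial datum.  For functions of this kind an \<open>L\<^sup>2\<close> bound
  implies a uniform bound, and a uniform bound implies a Lipschitz bound.

  Along a minimizing sequence \<open>u n\<close> the functions \<open>S (u n)\<close> are therefore uniformly bounded. The backward
  operator applied to \<open>S (u n)\<close> gives initial data with the same image under \<open>S\<close> which are uniformly
  bounded and uniformly Lipschitz. A subsequence converges locally uniformly, \<open>S\<close> is continuous for
  this convergence, and Fatou's lemma shows that the limit has minimal cost among all data
  in \<open>Lip0\<close>. It need not have compact support, but cutting it off first from above and then from
  below, far away from the support of the target, does not increase the cost.\<close>

section \<open>Uniformly convex Hamiltonians and their Legendre transform\<close>

lemma grad_eqI: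
  assumes "GDERIV f x :> D"
  shows "grad f x = D"
  unfolding grad_def
proof (rule the_equality)
  fix E assume "GDERIV f x :> E"
  then have "(\<lambda>h. h \<bullet> E) = (\<lambda>h. h \<bullet> D)"
    using assms unfolding gderiv_def by (blast intro: has_derivative_unique)
  then show "E = D"
    by (metis vector_eq_ldot)
qed (fact assms)

lemma linear_eq_inner_sum:
  fixes f :: "'a::euclidean_space \<Rightarrow> real"
  assumes "linear f"
  shows "f h = h \<bullet> (\<Sum>b\<in>Basis. f b *\<^sub>R b)"
proof -
  have "f h = f (\<Sum>b\<in>Basis. (h \<bullet> b) *\<^sub>R b)"
    by (simp add: euclidean_representation)
  also have "\<dots> = (\<Sum>b\<in>Basis. (h \<bullet> b) * f b)"
    by (simp add: linear_sum[OF assms] linear_cmul[OF assms])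
  finally show ?thesis
    by (simp add: inner_sum_right mult.commute)
qed

lemma has_derivative_imp_gderiv:
  fixes f :: "'a::euclidean_space \<Rightarrow> real"
  assumes "(f has_derivative f') (at x)"
  shows "GDERIV f x :> (\<Sum>b\<in>Basis. f' b *\<^sub>R b)"
proof -
  have "f' = (\<lambda>h. h \<bullet> (\<Sum>b\<in>Basis. f' b *\<^sub>R b))"
    using linear_eq_inner_sum[OF has_derivative_linear[OF assms]] by blast
  then show ?thesis
    using assms unfolding gderiv_def by metis
qed

lemma lipschitz_of_grad_bound:
  fixes f :: "'a::euclidean_space \<Rightarrow> real"
  assumes "\<And>x. GDERIV f x :> grad f x" and "\<And>x. norm (grad f x) \<le> C"
  shows "\<bar>f x - f y\<bar> \<le> C * norm (x - y)"
proof -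
  have "norm (f x - f y) \<le> C * norm (x - y)"
  proof (rule differentiable_bound[of UNIV])
    show "(f has_derivative (\<lambda>h. h \<bullet> grad f z)) (at z within UNIV)" for z
      using assms(1)[of z] by (simp add: gderiv_def)
    show "onorm (\<lambda>h. h \<bullet> grad f z) \<le> C" for z
    proof (rule onorm_le)
      fix h
      have "norm (h \<bullet> grad f z) \<le> norm h * norm (grad f z)"
        by (simp add: Cauchy_Schwarz_ineq2)
      also have "\<dots> \<le> C * norm h"
        using mult_left_mono[OF assms(2)[of z] norm_ge_zero[of h]] by (simp add: mult.commute)
      finally show "norm (h \<bullet> grad f z) \<le> C * norm h" .
    qed
  qed auto
  then show ?thesis by simp
qed

context
  fixes H :: "real^'n \<Rightarrow> real^'n \<Rightarrow> real"
  assumes C2: "C2 (\<lambda>(x, p). H x p)"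
begin

lemma continuous_H: "continuous_on UNIV (\<lambda>(x, p). H x p)"
  using C2 unfolding C2_def
  by (meson continuous_at_imp_continuous_on has_derivative_continuous)

lemma gderiv_H_x: "GDERIV (\<lambda>y. H y p) x :> H_x H x p"
proof -
  obtain D :: "(real^'n) \<times> (real^'n) \<Rightarrow> ((real^'n) \<times> (real^'n)) \<Rightarrow>\<^sub>L real"
    where D: "\<And>z. ((\<lambda>(x, p). H x p) has_derivative blinfun_apply (D z)) (at z)"
    using C2 unfolding C2_def by blast
  have "((\<lambda>y. (y, p)) has_derivative (\<lambda>h. (h, 0))) (at x)"
    by (auto intro!: derivative_eq_intros)
  from has_derivative_compose[OF this D]
  have "((\<lambda>y. H y p) has_derivative (\<lambda>h. D (x, p) (h, 0))) (at x)"
    by simp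
  from has_derivative_imp_gderiv[OF this] show ?thesis
    unfolding H_x_def by (simp only: grad_eqI)
qed

text \<open>The equation \<open>eq\<close> writes \<open>H_p\<close> through the full derivative
  \<open>D\<close>, so it inherits differentiability in the momentum from \<open>D\<close>. This
  makes the jacobian \<open>H_pp\<close> a genuine derivative.\<close>

lemma gderiv_H_p: "GDERIV (\<lambda>q. H x q) p :> H_p H x p"
  and differentiable_H_p: "(\<lambda>q. H_p H x q) differentiable (at p)"
proof -
  obtain D :: "(real^'n) \<times> (real^'n) \<Rightarrow> ((real^'n) \<times> (real^'n)) \<Rightarrow>\<^sub>L real" and D2
    where D: "\<And>z. ((\<lambda>(x, p). H x p) has_derivative blinfun_apply (D z)) (at z)"
      and D2: "\<And>z. (D has_derivative blinfun_apply (D2 z)) (at z)"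
    using C2 unfolding C2_def by blast
  have pair: "((\<lambda>q. (x, q)) has_derivative (\<lambda>h. (0, h))) (at p)" for p
    by (auto intro!: derivative_eq_intros)
  have "((\<lambda>q. H x q) has_derivative (\<lambda>h. D (x, p) (0, h))) (at p)" for p
    using has_derivative_compose[OF pair D] by simp
  from has_derivative_imp_gderiv[OF this]
  have g: "GDERIV (\<lambda>q. H x q) p :> (\<Sum>b\<in>Basis. D (x, p) (0, b) *\<^sub>R b)" for p .
  then have eq: "H_p H x p = (\<Sum>b\<in>Basis. D (x, p) (0, b) *\<^sub>R b)" for p
    unfolding H_p_def by (rule grad_eqI)
  show "GDERIV (\<lambda>q. H x q) p :> H_p H x p"
    using g[of p] by (simp only: eq)
  have d: "((\<lambda>q. D (x, q)) has_derivative (\<lambda>h. D2 (x, p) (0, h))) (at p)"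
    using has_derivative_compose[OF pair D2] by simp
  show "(\<lambda>q. H_p H x q) differentiable (at p)"
    unfolding eq differentiable_def
    by (rule exI, rule has_derivative_sum, rule has_derivative_scaleR_left,
        rule bounded_linear.has_derivative[OF blinfun.bounded_linear_left d])
qed

text \<open>On the segment from \<open>p\<close> to \<open>q\<close>, the Hessian bound makes
  \<open>H\<close> minus the quadratic \<open>c / 2 * (d \<bullet> d) * t\<^sup>2\<close> convex in
  \<open>t\<close>. At the midpoint the quadratic terms leave
  \<open>c / 4 - c / 8 = c / 8\<close>.\<close>

lemma H_midpoint:
  assumes pp: "\<And>x p. loewner_le (c *\<^sub>R mat 1) (H_pp H x p)"
  shows "H x ((1/2) *\<^sub>R (p + q)) \<le> (H x p + H x q) / 2 - c / 8 * (norm (p - q))\<^sup>2"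
proof -
  define d where "d = q - p"
  define g where "g = (\<lambda>t::real. H x (p + t *\<^sub>R d) - c / 2 * (d \<bullet> d) * t\<^sup>2)"
  define g' where "g' = (\<lambda>t. d \<bullet> H_p H x (p + t *\<^sub>R d) - c * (d \<bullet> d) * t)"
  define g'' where "g'' = (\<lambda>t. d \<bullet> (H_pp H x (p + t *\<^sub>R d) *v d) - c * (d \<bullet> d))"
  have line: "((\<lambda>t. p + t *\<^sub>R d) has_derivative (\<lambda>s. s *\<^sub>R d)) (at t)" for t
    by (auto intro!: derivative_eq_intros)
  have "(g has_real_derivative g' t) (at t)" for t
  proof -
    have "((\<lambda>t. H x (p + t *\<^sub>R d)) has_derivative (\<lambda>s. (s *\<^sub>R d) \<bullet> H_p H x (p + t *\<^sub>R d))) (at t)"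
      using has_derivative_compose[OF line gderiv_H_p[unfolded gderiv_def]] by simp
    then have "((\<lambda>t. H x (p + t *\<^sub>R d)) has_real_derivative (d \<bullet> H_p H x (p + t *\<^sub>R d))) (at t)"
      unfolding has_field_derivative_def
      by (rule has_derivative_eq_rhs) (simp add: fun_eq_iff)
    then show ?thesis
      unfolding g_def g'_def by (auto intro!: derivative_eq_intros)
  qed
  moreover have "(g' has_real_derivative g'' t) (at t)" for t
  proof -
    have "((\<lambda>q. H_p H x q) has_derivative (\<lambda>h. H_pp H x r *v h)) (at r)" for r
      using differentiable_H_p[of x r] unfolding H_pp_def jacobian_works .
    from has_derivative_compose[OF line this]
    have "((\<lambda>t. H_p H x (p + t *\<^sub>R d)) has_derivative
        (\<lambda>s. H_pp H x (p + t *\<^sub>R d) *v (s *\<^sub>R d))) (at t)" .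
    from has_derivative_inner_right[OF this, of d]
    have "((\<lambda>t. d \<bullet> H_p H x (p + t *\<^sub>R d)) has_real_derivative
        d \<bullet> (H_pp H x (p + t *\<^sub>R d) *v d)) (at t)"
      unfolding has_field_derivative_def
      by (rule has_derivative_eq_rhs) (simp add: matrix_vector_mult_scaleR fun_eq_iff)
    then show ?thesis
      unfolding g'_def g''_def by (auto intro!: derivative_eq_intros)
  qed
  moreover have "g'' t \<ge> 0" for t
  proof -
    have "d \<bullet> ((c *\<^sub>R mat 1) *v d) \<le> d \<bullet> (H_pp H x (p + t *\<^sub>R d) *v d)"
      using pp[of x "p + t *\<^sub>R d"] unfolding loewner_le_def by blast
    moreover have "(c *\<^sub>R mat 1) *v d = c *\<^sub>R d"
      by (metis scaleR_matrix_vector_assoc matrix_vector_mul_lid)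
    ultimately show ?thesis
      unfolding g''_def by simp
  qed
  ultimately have "convex_on UNIV g"
    by (intro f''_ge0_imp_convex[of _ g g' g'']) auto
  from convex_onD[OF this, of "1/2" 0 1] have "g (1/2) \<le> (g 0 + g 1) / 2"
    by simp
  moreover have mid: "p + (1/2) *\<^sub>R d = (1/2) *\<^sub>R (p + q)"
    by (simp add: d_def vec_eq_iff field_simps)
  have dd: "d \<bullet> d = (norm (p - q))\<^sup>2"
    by (simp add: d_def norm_minus_commute[of p q] dot_square_norm)
  have "g (1/2) = H x ((1/2) *\<^sub>R (p + q)) - c / 8 * (norm (p - q))\<^sup>2"
    and "g 0 = H x p" and "g 1 = H x q - c / 2 * (norm (p - q))\<^sup>2"
    unfolding g_def mid dd by (simp_all add: d_def power2_eq_square)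
  ultimately show ?thesis
    by (simp only: times_divide_eq_left) argo
qed

text \<open>The mean value inequality, starting from momentum \<open>0\<close>. This bound for
  momenta in the unit ball later yields linear growth of the Legendre transform.\<close>

lemma H_le_of_grad_bound:
  assumes B: "\<And>x p. norm p \<le> 1 \<Longrightarrow> norm (H_p H x p) \<le> B" and H_0: "\<And>x. H x 0 = 0"
    and p: "norm p \<le> 1"
  shows "H x p \<le> B"
proof -
  have "B \<ge> 0"
    by (rule order_trans[OF norm_ge_zero B[of 0 x]]) simp
  have "norm (H x p - H x 0) \<le> B * norm (p - 0)"
  proof (rule differentiable_bound[of "cball 0 1"])
    show "((\<lambda>q. H x q) has_derivative (\<lambda>h. h \<bullet> H_p H x q)) (at q within cball 0 1)" for q
      using gderiv_H_p[of x q] unfolding gderiv_def by (rule has_derivative_at_withinI)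
    show "onorm (\<lambda>h. h \<bullet> H_p H x q) \<le> B" if "q \<in> cball 0 1" for q
    proof (rule onorm_le)
      fix h
      have "norm (h \<bullet> H_p H x q) \<le> norm h * norm (H_p H x q)"
        by (simp add: Cauchy_Schwarz_ineq2)
      also have "\<dots> \<le> norm h * B"
        using B[of q x] that by (intro mult_left_mono) auto
      finally show "norm (h \<bullet> H_p H x q) \<le> B * norm h"
        by (simp add: mult.commute)
    qed
  qed (use p in auto)
  then have "H x p \<le> B * norm p" by (simp add: H_0)
  also have "\<dots> \<le> B"
    using p \<open>B \<ge> 0\<close> by (simp add: mult_left_le)
  finally show ?thesis .
qed

end

text \<open>The hypotheses on derivatives are traded for the inequalities that they imply; the
  analysis of the Lagrangian and of curves rests on these alone.\<close>

locale tame_hamiltonian =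
  fixes H :: "real^'n \<Rightarrow> real^'n \<Rightarrow> real" and c C B :: real
  assumes c_pos: "c > 0"
    and H_nonneg: "H x p \<ge> 0"
    and H_0: "H x 0 = 0"
    and H_continuous: "continuous_on UNIV (\<lambda>(x, p). H x p)"
    and H_lipschitz: "\<bar>H x p - H y p\<bar> \<le> C * norm (x - y)"
    and H_midconvex: "H x ((1/2) *\<^sub>R (p + q)) \<le> (H x p + H x q) / 2 - c / 8 * (norm (p - q))\<^sup>2"
    and H_bound: "norm p \<le> 1 \<Longrightarrow> H x p \<le> B"
begin

abbreviation L where "L \<equiv> legendre H"

lemma C_nonneg: "C \<ge> 0"
  \<comment> \<open>\<open>axis undefined 1\<close> is merely some unit vector.\<close>
  using H_lipschitz[of "axis undefined 1" 0 0] by (simp add: norm_eq_sqrt_inner inner_axis_axis)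

text \<open>Young's inequality, by completing the square. The weight \<open>c / 4\<close> fits both
  the quadratic growth of \<open>H\<close> and twice the midpoint gain \<open>c / 8\<close>.\<close>

lemma quad_le: "d \<bullet> w - c / 4 * (norm d)\<^sup>2 \<le> (norm w)\<^sup>2 / c" for d w :: "real^'n"
proof -
  have "0 \<le> (norm ((c/2) *\<^sub>R d - w))\<^sup>2"
    by simp
  also have "\<dots> = c * (c / 4 * (norm d)\<^sup>2 - d \<bullet> w + (norm w)\<^sup>2 / c)"
    using c_pos unfolding power2_norm_eq_inner
    by (simp add: inner_diff_left inner_diff_right inner_commute algebra_simps)
  finally show ?thesis
    using c_pos by (simp add: zero_le_mult_iff)
qed

text \<open>Convexity between \<open>p\<close> and the momentum \<open>0\<close>, where
  \<open>H\<close> vanishes: the value at the midpoint is nonnegative, so \<open>H x p / 2\<close>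
  must cover the gain.\<close>

lemma H_ge_quad: "c / 4 * (norm p)\<^sup>2 \<le> H x p"
  using H_midconvex[of x p 0] H_nonneg[of x "(1/2) *\<^sub>R p"] by (simp add: H_0)

lemma legendre_bdd: "bdd_above (range (\<lambda>p. p \<bullet> q - H x p))"
proof (rule bdd_aboveI2)
  show "p \<bullet> q - H x p \<le> (norm q)\<^sup>2 / c" for p
    using quad_le[of p q] H_ge_quad[of p x] by simp
qed

lemma legendre_ge: "p \<bullet> q - H x p \<le> L x q"
  unfolding legendre_def by (rule cSUP_upper[OF _ legendre_bdd]) simp

lemma legendre_leI: "(\<And>p. p \<bullet> q - H x p \<le> z) \<Longrightarrow> L x q \<le> z"
  unfolding legendre_def by (rule cSUP_least) auto

lemma legendre_nonneg: "L x q \<ge> 0"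
  using legendre_ge[of 0 q x] by (simp add: H_0)

lemma legendre_0: "L x 0 = 0"
  using legendre_nonneg[of x 0] legendre_leI[of 0 x 0] H_nonneg by force

lemma legendre_ge_inner: "norm p \<le> 1 \<Longrightarrow> p \<bullet> q - B \<le> L x q"
  using legendre_ge[of p q x] H_bound[of p x] by simp

lemma legendre_lipschitz: "L x q \<le> L y q + C * norm (x - y)"
proof (rule legendre_leI)
  show "p \<bullet> q - H x p \<le> L y q + C * norm (x - y)" for p
    using legendre_ge[of p q y] H_lipschitz[of x p y] by simp
qed

text \<open>Uniform convexity of \<open>H\<close> dualizes to a quadratic bound on second
  differences of \<open>L\<close>. Given competitors \<open>p\<close> and \<open>p'\<close> for the
  two suprema on the left, their midpoint competes for \<open>L x q\<close>, and the convexity gain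
  absorbs the term \<open>(p - p') \<bullet> w\<close>.\<close>

lemma legendre_second_difference:
  "L x (q + w) + L x (q - w) \<le> 2 * L x q + (norm w)\<^sup>2 / c"
proof -
  have pp: "p \<bullet> (q + w) - H x p + (p' \<bullet> (q - w) - H x p') \<le> 2 * L x q + (norm w)\<^sup>2 / c" for p p'
    using legendre_ge[of "(1/2) *\<^sub>R (p + p')" q x] H_midconvex[of x p p'] quad_le[of "p - p'" w]
    by (simp add: inner_simps field_simps)
  \<comment> \<open>The two suprema are taken one after the other, first over \<open>p\<close> and
    then over \<open>p'\<close>.\<close>
  have "p' \<bullet> (q - w) - H x p' \<le> 2 * L x q + (norm w)\<^sup>2 / c - L x (q + w)" for p'
  proof -
    have "L x (q + w) \<le> 2 * L x q + (norm w)\<^sup>2 / c - (p' \<bullet> (q - w) - H x p')"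
      using pp[of _ p'] by (intro legendre_leI) (simp add: algebra_simps)
    then show ?thesis by simp
  qed
  from legendre_leI[OF this] show ?thesis by simp
qed

text \<open>As a supremum of continuous functions, \<open>L\<close> is jointly lower semicontinuous:
  its strict superlevel sets are open.\<close>

lemma borel_measurable_legendre: "(\<lambda>z. L (fst z) (snd z)) \<in> borel_measurable borel"
  unfolding borel_measurable_iff_greater
proof safe
  fix a
  have "{z. a < L (fst z) (snd z)} = (\<Union>p. {z. a < p \<bullet> snd z - H (fst z) p})"
    using legendre_ge legendre_leI by (fastforce simp: not_less[symmetric] intro: less_le_trans)
  moreover have "open {z. a < p \<bullet> snd z - H (fst z) p}" for p
  proof (intro open_Collect_less continuous_intros)
    show "continuous_on UNIV (\<lambda>z. H (fst z) p)"
      by (rule continuous_on_compose2[OF H_continuous, of _ "\<lambda>z. (fst z, p)", simplified])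
        (intro continuous_intros)
  qed
  ultimately have "open {z. a < L (fst z) (snd z)}"
    by auto
  then show "{w \<in> space borel. a < L (fst w) (snd w)} \<in> sets borel"
    by simp
qed

end

section \<open>Absolutely continuous curves\<close>

lemma has_real_derivative_pos_part_sq:
  "((\<lambda>u. (max 0 u)\<^sup>2) has_real_derivative 2 * max 0 u) (at u)" for u :: real
proof -
  consider "u < 0" | "u = 0" | "u > 0" by linarith
  then show ?thesis
  proof cases
    case 1
    have "((\<lambda>u. (max 0 u)\<^sup>2) has_real_derivative 0) (at u)"
      by (rule has_field_derivative_transform_within_open[of "\<lambda>_. 0" _ _ "{..<0}"])
        (use 1 in auto)
    then show ?thesis using 1 by simp
  next
    case 2
    have "(\<lambda>h::real. (max 0 h)\<^sup>2 / h) = max 0"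
      by (auto simp: fun_eq_iff max_def power2_eq_square)
    moreover have "(max 0 \<longlongrightarrow> max 0 0) (at (0::real))"
      by (intro tendsto_max tendsto_const tendsto_ident_at)
    ultimately show ?thesis
      unfolding has_field_derivative_iff using 2 by simp
  next
    case 3
    have "((\<lambda>u. (max 0 u)\<^sup>2) has_real_derivative 2 * u) (at u)"
      by (rule has_field_derivative_transform_within_open[of "\<lambda>u. u\<^sup>2" _ _ "{0<..}"])
        (use 3 in \<open>auto intro!: derivative_eq_intros\<close>)
    then show ?thesis using 3 by simp
  qed
qed

text \<open>The step is \<open>P (u - l) / (P (u - l) + P (r - u))\<close> with \<open>P\<close> the
  squared positive part. The two summands of the denominator never vanish together because
  \<open>l < r\<close>.\<close>

lemma C1_step_exists:
  fixes l r :: real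
  assumes "l < r"
  obtains b b' where
    "\<And>t. (b has_real_derivative b' t) (at t)" "continuous_on UNIV b'" "\<And>t. 0 \<le> b' t"
    "\<And>t. t \<le> l \<Longrightarrow> b t = 0" "\<And>t. t \<ge> r \<Longrightarrow> b t = 1"
    "\<And>t. t \<le> l \<or> t \<ge> r \<Longrightarrow> b' t = 0" "\<And>t. 0 \<le> b t" "\<And>t. b t \<le> 1"
proof -
  define P where "P = (\<lambda>u::real. (max 0 u)\<^sup>2)"
  define N where "N = (\<lambda>u. P (u - l) + P (r - u))"
  have P_nonneg: "P u \<ge> 0" for u
    by (simp add: P_def)
  have N_pos: "N u > 0" for u
  proof (cases "u > l")
    case True
    then have "P (u - l) > 0" by (simp add: P_def)
    then show ?thesis using P_nonneg[of "r - u"] by (simp add: N_def)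
  next
    case False
    then have "P (r - u) > 0" using assms by (simp add: P_def)
    then show ?thesis using P_nonneg[of "u - l"] by (simp add: N_def)
  qed
  define b where "b = (\<lambda>u. P (u - l) / N u)"
  define b' where "b' = (\<lambda>u. 2 * (max 0 (u - l) * P (r - u) + P (u - l) * max 0 (r - u)) / (N u)\<^sup>2)"
  have dP: "((\<lambda>u. P (f u)) has_real_derivative 2 * max 0 (f u) * f') (at u)"
    if "(f has_real_derivative f') (at u)" for f f' u
    using DERIV_chain2[OF has_real_derivative_pos_part_sq that] unfolding P_def .
  show ?thesis
  proof
    show "(b has_real_derivative b' t) (at t)" for t
    proof -
      have "N t \<noteq> 0" using N_pos[of t] by simp
      have 1: "((\<lambda>u. P (u - l)) has_real_derivative 2 * max 0 (t - l)) (at t)"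
        by (rule dP[where f' = 1, simplified]) (auto intro!: derivative_eq_intros)
      have 2: "((\<lambda>u. P (r - u)) has_real_derivative - 2 * max 0 (r - t)) (at t)"
      proof -
        have "((\<lambda>u. r - u) has_real_derivative -1) (at t)"
          by (auto intro!: derivative_eq_intros)
        from dP[OF this] show ?thesis by simp
      qed
      have "(N has_real_derivative 2 * max 0 (t - l) - 2 * max 0 (r - t)) (at t)"
        unfolding N_def using DERIV_add[OF 1 2] by simp
      from DERIV_divide[OF 1 this \<open>N t \<noteq> 0\<close>]
      show ?thesis
        unfolding b_def by (rule DERIV_cong) (simp add: b'_def N_def power2_eq_square algebra_simps)
    qed
    have cP: "continuous_on UNIV P"
      unfolding P_def by (intro continuous_intros)
    have cPf: "continuous_on UNIV (\<lambda>u. P (f u))" if "continuous_on UNIV f" for f :: "real \<Rightarrow> real"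
      using continuous_on_compose2[OF cP that] by simp
    show "continuous_on UNIV b'"
      unfolding b'_def N_def
      by (intro continuous_intros cPf) (use N_pos[unfolded N_def] in \<open>metis less_irrefl power_not_zero\<close>)
    show "0 \<le> b' t" for t
      unfolding b'_def using P_nonneg by simp
    show "b t = 0" if "t \<le> l" for t
      using that by (simp add: b_def P_def)
    show "b t = 1" if "t \<ge> r" for t
      using that assms by (simp add: b_def P_def N_def)
    show "b' t = 0" if "t \<le> l \<or> t \<ge> r" for t
      using that by (auto simp: b'_def P_def)
    show "0 \<le> b t" for t
      using P_nonneg N_pos[of t] by (simp add: b_def less_imp_le)
    show "b t \<le> 1" for t
      using P_nonneg[of "r - t"] N_pos[of t] by (simp add: b_def N_def)
  qed
qed

section \<open>Integrals over open intervals and calculus in \<open>W11\<close>\<close>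

lemma set_integral_open_interval:
  fixes f :: "real \<Rightarrow> 'a::euclidean_space"
  assumes "continuous_on {a..b} f"
  shows "set_integrable lborel {a<..<b} f"
    and "(LINT t:{a<..<b}|lborel. f t) = integral {a..b} f"
proof -
  show i: "set_integrable lborel {a<..<b} f"
    by (rule set_integrable_subset[OF borel_integrable_atLeastAtMost'[OF assms]]) auto
  show "(LINT t:{a<..<b}|lborel. f t) = integral {a..b} f"
    using set_borel_integral_eq_integral(2)[OF i] by (simp add: integral_open_interval_real)
qed

lemma set_integral_derivative:
  fixes f :: "real \<Rightarrow> 'a::euclidean_space"
  assumes "a \<le> b" "\<And>t. (F has_vector_derivative f t) (at t)" "continuous_on UNIV f"
  shows "(LINT t:{a<..<b}|lborel. f t) = F b - F a"
proof -
  have "continuous_on {a..b} f"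
    using assms(3) continuous_on_subset by blast
  moreover have "(f has_integral F b - F a) {a..b}"
    by (rule fundamental_theorem_of_calculus)
      (use assms in \<open>auto intro: has_vector_derivative_at_within\<close>)
  ultimately show ?thesis
    by (simp add: set_integral_open_interval integral_unique)
qed

lemma set_integrable_continuous_scaleR:
  fixes v :: "real \<Rightarrow> 'a::euclidean_space"
  assumes v: "set_integrable lborel {a<..<b} v" and \<phi>: "continuous_on UNIV \<phi>"
  shows "set_integrable lborel {a<..<b} (\<lambda>t. \<phi> t *\<^sub>R v t)"
proof -
  have "compact (\<phi> ` {a..b})"
    by (rule compact_continuous_image) (use \<phi> continuous_on_subset in blast)+
  then obtain B where B: "\<And>t. t \<in> {a..b} \<Longrightarrow> norm (\<phi> t) \<le> B"
    using bounded_iff compact_imp_bounded by (metis imageI)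
  have "integrable lborel (\<lambda>t. B *\<^sub>R (indicator {a<..<b} t *\<^sub>R v t))"
    using v unfolding set_integrable_def by (rule integrable_scaleR_right)
  then show ?thesis
    unfolding set_integrable_def
  proof (rule Bochner_Integration.integrable_bound)
    have "\<phi> \<in> borel_measurable lborel"
      using \<phi> by (simp add: borel_measurable_continuous_onI)
    from borel_measurable_scaleR[OF this borel_measurable_integrable[OF v[unfolded set_integrable_def]]]
    have "(\<lambda>t. \<phi> t *\<^sub>R (indicator {a<..<b} t *\<^sub>R v t)) \<in> borel_measurable lborel" .
    then show "(\<lambda>t. indicator {a<..<b} t *\<^sub>R \<phi> t *\<^sub>R v t) \<in> borel_measurable lborel"
      by (simp add: mult.commute)
    show "AE t in lborel. norm (indicator {a<..<b} t *\<^sub>R \<phi> t *\<^sub>R v t)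
        \<le> norm (B *\<^sub>R (indicator {a<..<b} t *\<^sub>R v t))"
    proof (rule AE_I2)
      fix t
      have "norm (\<phi> t) \<le> norm B" if "t \<in> {a<..<b}"
        using B[of t] that by auto
      then show "norm (indicator {a<..<b} t *\<^sub>R \<phi> t *\<^sub>R v t)
        \<le> norm (B *\<^sub>R (indicator {a<..<b} t *\<^sub>R v t))"
        by (auto simp: indicator_def mult_right_mono)
    qed
  qed
qed

lemma test_funD:
  assumes "test_fun T \<phi> \<phi>'"
  shows "\<And>t. (\<phi> has_real_derivative \<phi>' t) (at t)" "continuous_on UNIV \<phi>'"
    "continuous_on UNIV \<phi>" "\<phi> 0 = 0" "\<phi> T = 0"
proof -
  show d: "\<And>t. (\<phi> has_real_derivative \<phi>' t) (at t)" and "continuous_on UNIV \<phi>'"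
    using assms by (auto simp: test_fun_def)
  show "continuous_on UNIV \<phi>"
    by (intro continuous_at_imp_continuous_on ballI DERIV_isCont[OF d])
  have "{t. \<phi> t \<noteq> 0} \<subseteq> {0<..<T}"
    by (rule order_trans[OF closure_subset]) (use assms in \<open>simp add: test_fun_def\<close>)
  then show "\<phi> 0 = 0" "\<phi> T = 0"
    by auto
qed

text \<open>Integration by parts: the derivative of \<open>\<phi> t *\<^sub>R \<eta> t\<close>
  integrates to zero, since test functions vanish at both ends.\<close>

lemma W11_C1:
  assumes "T \<ge> 0" and \<eta>: "\<And>t. (\<eta> has_vector_derivative \<eta>' t) (at t)" and c: "continuous_on UNIV \<eta>'"
  shows "W11 T \<eta> \<eta>'"
  unfolding W11_def
proof (intro conjI allI impI)
  have c\<eta>: "continuous_on UNIV \<eta>"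
    by (intro continuous_at_imp_continuous_on ballI has_vector_derivative_continuous[OF \<eta>])
  then show "continuous_on {0..T} \<eta>"
    using continuous_on_subset by blast
  show "set_integrable lborel {0<..<T} \<eta>'"
    using set_integral_open_interval(1) c continuous_on_subset by blast
  fix \<phi> \<phi>' assume "test_fun T \<phi> \<phi>'"
  note \<phi> = test_funD[OF this]
  have "(LINT t:{0<..<T}|lborel. \<phi> t *\<^sub>R \<eta>' t + \<phi>' t *\<^sub>R \<eta> t) = \<phi> T *\<^sub>R \<eta> T - \<phi> 0 *\<^sub>R \<eta> 0"
  proof (rule set_integral_derivative)
    show "((\<lambda>t. \<phi> t *\<^sub>R \<eta> t) has_vector_derivative \<phi> t *\<^sub>R \<eta>' t + \<phi>' t *\<^sub>R \<eta> t) (at t)" for t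
      using has_vector_derivative_scaleR[OF \<phi>(1) \<eta>] .
  qed (use assms(1) c c\<eta> \<phi> in \<open>auto intro!: continuous_intros\<close>)
  moreover have "(LINT t:{0<..<T}|lborel. \<phi> t *\<^sub>R \<eta>' t + \<phi>' t *\<^sub>R \<eta> t)
      = (LINT t:{0<..<T}|lborel. \<phi> t *\<^sub>R \<eta>' t) + (LINT t:{0<..<T}|lborel. \<phi>' t *\<^sub>R \<eta> t)"
    by (intro set_integral_add set_integral_open_interval)
      (use c c\<eta> \<phi> in \<open>auto intro!: continuous_intros intro: continuous_on_subset\<close>)
  ultimately show "(LINT t:{0<..<T}|lborel. \<phi>' t *\<^sub>R \<eta> t) = - (LINT t:{0<..<T}|lborel. \<phi> t *\<^sub>R \<eta>' t)"
    using \<phi>(4,5) by (simp add: eq_neg_iff_add_eq_0 add.commute)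
qed

lemma W11_add:
  assumes 1: "W11 T \<xi> v" and 2: "W11 T \<eta> w"
  shows "W11 T (\<lambda>t. \<xi> t + \<eta> t) (\<lambda>t. v t + w t)"
proof -
  have int: "set_integrable lborel {0<..<T} (\<lambda>t. \<phi>' t *\<^sub>R \<xi> t)"
      "set_integrable lborel {0<..<T} (\<lambda>t. \<phi> t *\<^sub>R v t)"
    if "W11 T \<xi> v" "test_fun T \<phi> \<phi>'" for \<phi> \<phi>' and \<xi> v :: "real \<Rightarrow> real^'a"
  proof -
    note \<phi> = test_funD[OF that(2)]
    show "set_integrable lborel {0<..<T} (\<lambda>t. \<phi>' t *\<^sub>R \<xi> t)"
      using that(1) unfolding W11_def
      by (intro set_integral_open_interval continuous_on_scaleR)
        (auto intro: continuous_on_subset[OF \<phi>(2)])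
    show "set_integrable lborel {0<..<T} (\<lambda>t. \<phi> t *\<^sub>R v t)"
      using that(1) \<phi>(3) unfolding W11_def by (blast intro: set_integrable_continuous_scaleR)
  qed
  show ?thesis
    unfolding W11_def
  proof (intro conjI allI impI)
    show "continuous_on {0..T} (\<lambda>t. \<xi> t + \<eta> t)"
      using 1 2 unfolding W11_def by (intro continuous_intros) auto
    show "set_integrable lborel {0<..<T} (\<lambda>t. v t + w t)"
      using 1 2 unfolding W11_def by (intro set_integral_add) auto
    fix \<phi> \<phi>' assume t: "test_fun T \<phi> \<phi>'"
    with 1 2 show "(LINT t:{0<..<T}|lborel. \<phi>' t *\<^sub>R (\<xi> t + \<eta> t))
        = - (LINT t:{0<..<T}|lborel. \<phi> t *\<^sub>R (v t + w t))"
      unfolding scaleR_right_distrib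
      by (subst (1 2) set_integral_add) (auto intro: int simp: W11_def)
  qed
qed

text \<open>A weighted average is close to \<open>z\<close> if the averaged function is so wherever
  the weight lives. The weight will be the derivative of a cutoff, concentrated near one end of the
  interval.\<close>

lemma set_integral_concentrated:
  fixes g w :: "real \<Rightarrow> real"
  assumes g: "continuous_on {a..b} g" and w: "continuous_on UNIV w"
    and nonneg: "\<And>t. w t \<ge> 0" and one: "(LINT t:{a<..<b}|lborel. w t) = 1"
    and close: "\<And>t. t \<in> {a<..<b} \<Longrightarrow> w t \<noteq> 0 \<Longrightarrow> \<bar>g t - z\<bar> \<le> \<delta>"
  shows "\<bar>(LINT t:{a<..<b}|lborel. w t * g t) - z\<bar> \<le> \<delta>"
proof -
  have cw: "continuous_on {a..b} w"
    using w continuous_on_subset by blast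
  note int = set_integral_open_interval(1)
  have "(LINT t:{a<..<b}|lborel. w t * g t) - z = (LINT t:{a<..<b}|lborel. w t * g t) - (LINT t:{a<..<b}|lborel. w t * z)"
    using one by simp
  also have "\<dots> = (LINT t:{a<..<b}|lborel. w t * g t - w t * z)"
    by (rule set_integral_diff(2)[symmetric]; intro int continuous_intros cw g)
  finally have eq: "(LINT t:{a<..<b}|lborel. w t * g t) - z = (LINT t:{a<..<b}|lborel. w t * g t - w t * z)" .
  have pt: "\<bar>w t * g t - w t * z\<bar> \<le> w t * \<delta>" if "t \<in> {a<..<b}" for t
  proof (cases "w t = 0")
    case False
    have "\<bar>w t * g t - w t * z\<bar> = w t * \<bar>g t - z\<bar>"
      using nonneg[of t] by (simp add: abs_mult flip: right_diff_distrib)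
    then show ?thesis
      using close[OF that False] nonneg[of t] by (simp add: mult_left_mono)
  qed simp
  have i: "set_integrable lborel {a<..<b} (\<lambda>t. w t * g t - w t * z)"
      "set_integrable lborel {a<..<b} (\<lambda>t. w t * d)" for d
    by (intro int continuous_intros cw g)+
  have c: "(LINT t:{a<..<b}|lborel. w t * d) = d" for d
    using one by simp
  have "(LINT t:{a<..<b}|lborel. w t * g t - w t * z) \<le> (LINT t:{a<..<b}|lborel. w t * \<delta>)"
    by (rule set_integral_mono[OF i]) (use pt abs_le_D1 in blast)
  moreover have "(LINT t:{a<..<b}|lborel. w t * (- \<delta>)) \<le> (LINT t:{a<..<b}|lborel. w t * g t - w t * z)"
  proof (rule set_integral_mono[OF i(2) i(1)])
    show "w t * (- \<delta>) \<le> w t * g t - w t * z" if "t \<in> {a<..<b}" for t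
      using abs_le_D2[OF pt[OF that]] by simp
  qed
  ultimately show ?thesis
    unfolding c eq[symmetric] by linarith
qed

text \<open>A curve of class \<open>W11\<close> is only known through its pairing with test functions; cutting off
  the constant \<open>1\<close> near the two ends of the interval recovers its increment up to \<open>\<delta>\<close>.\<close>

lemma W11_increment_approx:
  assumes "T > 0" and W: "W11 T \<xi> v" and "\<delta> > 0"
  obtains \<phi> where "continuous_on UNIV \<phi>" "\<And>t. 0 \<le> \<phi> t" "\<And>t. \<phi> t \<le> 1"
    "p \<bullet> (\<xi> T - \<xi> 0) \<le> (LINT t:{0<..<T}|lborel. \<phi> t * (p \<bullet> v t)) + \<delta>"
proof -
  define g where "g = (\<lambda>t. p \<bullet> \<xi> t)"
  have cg: "continuous_on {0..T} g"
    using W unfolding g_def W11_def by (intro continuous_intros) auto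
  have near: "\<exists>d>0. \<forall>t\<in>{0..T}. \<bar>t - s\<bar> < d \<longrightarrow> \<bar>g t - g s\<bar> \<le> \<delta> / 2" if "s \<in> {0..T}" for s
    using cg that \<open>\<delta> > 0\<close> unfolding continuous_on_iff dist_real_def
    by (meson half_gt_zero less_imp_le)
  obtain d0 where d0: "d0 > 0" "\<And>t. t \<in> {0..T} \<Longrightarrow> \<bar>t\<bar> < d0 \<Longrightarrow> \<bar>g t - g 0\<bar> \<le> \<delta> / 2"
    using near[of 0] \<open>T > 0\<close> by auto
  obtain d1 where d1: "d1 > 0" "\<And>t. t \<in> {0..T} \<Longrightarrow> \<bar>t - T\<bar> < d1 \<Longrightarrow> \<bar>g t - g T\<bar> \<le> \<delta> / 2"
    using near[of T] \<open>T > 0\<close> by auto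
  \<comment> \<open>The bound \<open>T / 4\<close> keeps the two ramps of the cutoff, on
    \<open>[e, 2 * e]\<close> and \<open>[T - 2 * e, T - e]\<close>, apart; the other two bounds
    keep them where \<open>g\<close> is within \<open>\<delta> / 2\<close> of its end
    values.\<close>
  define e where "e = min (T / 4) (min (d0 / 2) (d1 / 2))"
  have e: "0 < e" "4 * e \<le> T" "2 * e \<le> d0" "2 * e \<le> d1"
    using d0 d1 \<open>T > 0\<close> by (auto simp: e_def min_def)
  obtain b b' where b: "\<And>t. (b has_real_derivative b' t) (at t)" "continuous_on UNIV b'"
      "\<And>t. 0 \<le> b' t" "\<And>t. t \<le> e \<Longrightarrow> b t = 0" "\<And>t. t \<ge> 2 * e \<Longrightarrow> b t = 1"
      "\<And>t. t \<le> e \<or> t \<ge> 2 * e \<Longrightarrow> b' t = 0" "\<And>t. 0 \<le> b t" "\<And>t. b t \<le> 1"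
    by (rule C1_step_exists[of e "2 * e"]) (use e(1) in auto)
  \<comment> \<open>A plateau of height \<open>1\<close> with a ramp at each end. A sum of two
    steps, rather than a product, splits \<open>\<phi>'\<close> into one weight per end.\<close>
  define \<phi> where "\<phi> = (\<lambda>t. b t + b (T - t) - 1)"
  define \<phi>' where "\<phi>' = (\<lambda>t. b' t - b' (T - t))"
  have db: "((\<lambda>t. b (T - t)) has_real_derivative - b' (T - t)) (at t)" for t
  proof -
    have "((\<lambda>u. T - u) has_real_derivative -1) (at t)"
      by (auto intro!: derivative_eq_intros)
    from DERIV_chain2[OF b(1) this] show ?thesis by simp
  qed
  have cb': "continuous_on UNIV (\<lambda>t. b' (T - t))"
    by (rule continuous_on_compose2[OF b(2)]) (auto intro: continuous_intros)
  have supp: "{t. \<phi> t \<noteq> 0} \<subseteq> {e..T - e}"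
  proof
    fix t assume t: "t \<in> {t. \<phi> t \<noteq> 0}"
    show "t \<in> {e..T - e}"
    proof (rule ccontr)
      assume "t \<notin> {e..T - e}"
      then consider "t \<le> e" | "T - t \<le> e" by fastforce
      then show False
      proof cases
        case 1 then show False using t b(4)[of t] b(5)[of "T - t"] e by (simp add: \<phi>_def)
      next
        case 2 then show False using t b(4)[of "T - t"] b(5)[of t] e by (simp add: \<phi>_def)
      qed
    qed
  qed
  have "closure {t. \<phi> t \<noteq> 0} \<subseteq> {e..T - e}"
    using supp by (simp add: closure_minimal)
  moreover from this have "compact (closure {t. \<phi> t \<noteq> 0})"
    by (meson bounded_closed_interval bounded_subset closed_closure compact_eq_bounded_closed)
  moreover have d\<phi>: "(\<phi> has_real_derivative \<phi>' t) (at t)" for t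
    unfolding \<phi>_def \<phi>'_def using DERIV_diff[OF DERIV_add[OF b(1) db] DERIV_const] by simp
  moreover have "continuous_on UNIV \<phi>'"
    unfolding \<phi>'_def by (intro continuous_intros b(2) cb')
  ultimately have test: "test_fun T \<phi> \<phi>'"
    using e(1) unfolding test_fun_def by auto
  have cx: "continuous_on {0..T} \<xi>" and iv: "set_integrable lborel {0<..<T} v"
    using W by (auto simp: W11_def)
  have c\<phi>: "continuous_on {0..T} \<phi>'" "continuous_on {0..T} b'" "continuous_on {0..T} (\<lambda>t. b' (T - t))"
    using test_funD(2)[OF test] b(2) cb' continuous_on_subset by blast+
  note int = set_integral_open_interval(1)
  \<comment> \<open>The weak derivative turns the pairing with \<open>v\<close> into an average of
    \<open>g\<close> near \<open>T\<close> minus an average of \<open>g\<close> near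
    \<open>0\<close>.\<close>
  have "(LINT t:{0<..<T}|lborel. \<phi> t * (p \<bullet> v t)) = p \<bullet> (LINT t:{0<..<T}|lborel. \<phi> t *\<^sub>R v t)"
    using set_integrable_continuous_scaleR[OF iv test_funD(3)[OF test]]
    unfolding set_lebesgue_integral_def set_integrable_def
    by (subst integral_inner_right[symmetric]) (auto simp: mult.assoc)
  also have "\<dots> = - (p \<bullet> (LINT t:{0<..<T}|lborel. \<phi>' t *\<^sub>R \<xi> t))"
    using W test unfolding W11_def by simp
  also have "p \<bullet> (LINT t:{0<..<T}|lborel. \<phi>' t *\<^sub>R \<xi> t) = (LINT t:{0<..<T}|lborel. \<phi>' t * g t)"
    using int[of 0 T "\<lambda>t. \<phi>' t *\<^sub>R \<xi> t"] c\<phi>(1) cx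
    unfolding set_lebesgue_integral_def set_integrable_def g_def
    by (subst integral_inner_right[symmetric]) (auto intro: continuous_on_scaleR simp: mult.assoc)
  also have "\<dots> = (LINT t:{0<..<T}|lborel. b' t * g t) - (LINT t:{0<..<T}|lborel. b' (T - t) * g t)"
    unfolding \<phi>'_def left_diff_distrib
    by (rule set_integral_diff; intro int continuous_intros c\<phi> cg)
  finally have eq: "(LINT t:{0<..<T}|lborel. \<phi> t * (p \<bullet> v t))
      = (LINT t:{0<..<T}|lborel. b' (T - t) * g t) - (LINT t:{0<..<T}|lborel. b' t * g t)"
    by simp
  have "\<bar>(LINT t:{0<..<T}|lborel. b' t * g t) - g 0\<bar> \<le> \<delta> / 2"
  proof (rule set_integral_concentrated[OF cg b(2) b(3)])
    show "(LINT t:{0<..<T}|lborel. b' t) = 1"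
      using set_integral_derivative[of 0 T b b'] b(1,2) b(4)[of 0] b(5)[of T] e
      by (simp add: has_real_derivative_iff_has_vector_derivative)
    show "\<bar>g t - g 0\<bar> \<le> \<delta> / 2" if "t \<in> {0<..<T}" "b' t \<noteq> 0" for t
      using d0(2)[of t] that b(6)[of t] e by force
  qed
  moreover have "\<bar>(LINT t:{0<..<T}|lborel. b' (T - t) * g t) - g T\<bar> \<le> \<delta> / 2"
  proof (rule set_integral_concentrated[OF cg cb' b(3)])
    have "((\<lambda>t. - b (T - t)) has_vector_derivative b' (T - t)) (at t)" for t
      using DERIV_minus[OF db[of t]] by (simp add: has_real_derivative_iff_has_vector_derivative)
    then show "(LINT t:{0<..<T}|lborel. b' (T - t)) = 1"
      using set_integral_derivative[of 0 T "\<lambda>t. - b (T - t)" "\<lambda>t. b' (T - t)"]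
        cb' b(4)[of 0] b(5)[of T] e by simp
    show "\<bar>g t - g T\<bar> \<le> \<delta> / 2" if "t \<in> {0<..<T}" "b' (T - t) \<noteq> 0" for t
      using d1(2)[of t] that b(6)[of "T - t"] e by force
  qed
  ultimately have "g T - g 0 \<le> (LINT t:{0<..<T}|lborel. \<phi> t * (p \<bullet> v t)) + \<delta>"
    unfolding eq by linarith
  moreover have "0 \<le> \<phi> t" "\<phi> t \<le> 1" for t
  proof -
    show "\<phi> t \<le> 1" using b(8)[of t] b(8)[of "T - t"] by (simp add: \<phi>_def)
    have "2 * e \<le> t \<or> 2 * e \<le> T - t" using e by linarith
    then show "0 \<le> \<phi> t"
      using b(5)[of t] b(5)[of "T - t"] b(7)[of t] b(7)[of "T - t"] by (auto simp: \<phi>_def)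
  qed
  ultimately show ?thesis
    using that[of \<phi>] test_funD(3)[OF test] by (simp add: g_def inner_diff_right)
qed

section \<open>The action of curves\<close>

text \<open>The competitors are those of \<open>S_plus\<close> with both ends fixed. Recording every
  attained action instead of the minimal one avoids having to find optimal curves.\<close>

definition joins ::
    "(real^'n \<Rightarrow> real^'n \<Rightarrow> real) \<Rightarrow> real \<Rightarrow> real^'n \<Rightarrow> real^'n \<Rightarrow> real \<Rightarrow> bool" where
  "joins H T y x a \<longleftrightarrow> (\<exists>\<xi> v. W11 T \<xi> v \<and> \<xi> 0 = y \<and> \<xi> T = x \<and>
     set_integrable lborel {0<..<T} (\<lambda>s. legendre H (\<xi> s) (v s)) \<and>
     a = (LINT s:{0<..<T}|lborel. legendre H (\<xi> s) (v s)))"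

context tame_hamiltonian
begin

text \<open>Domination, as the Lagrangian is nonnegative. Measurability is known for
  \<open>\<xi>\<close> and \<open>v\<close> only on the open interval, so both are multiplied by its
  indicator before \<open>L\<close> is applied.\<close>

lemma set_integrable_legendre:
  assumes W: "W11 T \<xi> v" and F: "set_integrable lborel {0<..<T} F"
    and le: "\<And>s. s \<in> {0<..<T} \<Longrightarrow> L (\<xi> s) (v s) \<le> F s"
  shows "set_integrable lborel {0<..<T} (\<lambda>s. L (\<xi> s) (v s))"
proof -
  let ?I = "indicat_real {0<..<T}"
  have "continuous_on {0<..<T} \<xi>"
    using W unfolding W11_def by (auto intro: continuous_on_subset)
  then have "(\<lambda>s. ?I s *\<^sub>R \<xi> s) \<in> borel_measurable borel"
    by (rule borel_measurable_continuous_on_indicator[rotated]) simp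
  moreover have "(\<lambda>s. ?I s *\<^sub>R v s) \<in> borel_measurable borel"
    using W unfolding W11_def set_integrable_def by (auto dest: borel_measurable_integrable)
  ultimately have "(\<lambda>s. (?I s *\<^sub>R \<xi> s, ?I s *\<^sub>R v s)) \<in> borel_measurable borel"
    by (rule borel_measurable_Pair)
  from measurable_compose[OF this borel_measurable_legendre]
  have "(\<lambda>s. L (?I s *\<^sub>R \<xi> s) (?I s *\<^sub>R v s)) \<in> borel_measurable lborel"
    by simp
  then have "(\<lambda>s. ?I s *\<^sub>R L (?I s *\<^sub>R \<xi> s) (?I s *\<^sub>R v s)) \<in> borel_measurable lborel"
    by (intro borel_measurable_scaleR) auto
  moreover have "(\<lambda>s. ?I s *\<^sub>R L (?I s *\<^sub>R \<xi> s) (?I s *\<^sub>R v s)) = (\<lambda>s. ?I s *\<^sub>R L (\<xi> s) (v s))"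
    by (auto simp: indicator_def)
  ultimately have m: "(\<lambda>s. ?I s *\<^sub>R L (\<xi> s) (v s)) \<in> borel_measurable lborel"
    by simp
  show ?thesis
    unfolding set_integrable_def
  proof (rule Bochner_Integration.integrable_bound[OF F[unfolded set_integrable_def] m], rule AE_I2)
    show "norm (?I s *\<^sub>R L (\<xi> s) (v s)) \<le> norm (?I s *\<^sub>R F s)" for s
      using le[of s] legendre_nonneg[of "\<xi> s" "v s"] by (auto simp: indicator_def)
  qed
qed

lemma joins_nonneg: "joins H T y x a \<Longrightarrow> a \<ge> 0"
  unfolding joins_def set_lebesgue_integral_def
  by (auto intro!: integral_nonneg_AE AE_I2 mult_nonneg_nonneg legendre_nonneg)

lemma joins_refl:
  assumes "T > 0"
  shows "joins H T x x 0"
proof -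
  have "W11 T (\<lambda>_. x) (\<lambda>_. 0)"
    by (rule W11_C1) (use assms in auto)
  moreover have "set_integrable lborel {0<..<T} (\<lambda>_. L x 0)"
    by (simp add: legendre_0 set_integrable_def)
  ultimately show ?thesis
    unfolding joins_def
    by (intro exI[of _ "\<lambda>_. x"] exI[of _ "\<lambda>_. 0"]) (simp add: legendre_0 set_lebesgue_integral_def)
qed

lemma joins_coercive:
  assumes "T > 0" and j: "joins H T y x a"
  shows "norm (x - y) \<le> a + B * T"
proof (rule field_le_epsilon)
  fix \<delta> :: real assume "\<delta> > 0"
  obtain \<xi> v where W: "W11 T \<xi> v" and ends: "\<xi> 0 = y" "\<xi> T = x"
    and int: "set_integrable lborel {0<..<T} (\<lambda>s. L (\<xi> s) (v s))"
    and a: "a = (LINT s:{0<..<T}|lborel. L (\<xi> s) (v s))"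
    using j unfolding joins_def by auto
  define p where "p = sgn (x - y)"
  have p: "norm p \<le> 1" and px: "p \<bullet> (x - y) = norm (x - y)"
    by (simp add: p_def norm_sgn, cases "x = y")
      (simp_all add: p_def sgn_div_norm dot_square_norm power2_eq_square)
  have "B \<ge> 0"
    using H_bound[of 0 0] by (simp add: H_0)
  obtain \<phi> where \<phi>: "continuous_on UNIV \<phi>" "\<And>t. 0 \<le> \<phi> t" "\<And>t. \<phi> t \<le> 1"
    and incr: "p \<bullet> (\<xi> T - \<xi> 0) \<le> (LINT t:{0<..<T}|lborel. \<phi> t * (p \<bullet> v t)) + \<delta>"
    by (rule W11_increment_approx[OF assms(1) W \<open>\<delta> > 0\<close>, of p]) (rule that)
  have iB: "set_integrable lborel {0<..<T} (\<lambda>_. B)"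
    by (intro set_integral_open_interval continuous_intros)
  have "set_integrable lborel {0<..<T} (\<lambda>t. \<phi> t *\<^sub>R v t)"
    using W \<phi>(1) by (auto simp: W11_def intro: set_integrable_continuous_scaleR)
  then have "integrable lborel (\<lambda>t. p \<bullet> (indicator {0<..<T} t *\<^sub>R \<phi> t *\<^sub>R v t))"
    unfolding set_integrable_def by (intro integrable_inner_right) simp
  then have i\<phi>: "set_integrable lborel {0<..<T} (\<lambda>t. \<phi> t * (p \<bullet> v t))"
    unfolding set_integrable_def by (simp add: mult.assoc)
  have "(LINT t:{0<..<T}|lborel. \<phi> t * (p \<bullet> v t)) \<le> (LINT t:{0<..<T}|lborel. L (\<xi> t) (v t) + B)"
  proof (rule set_integral_mono[OF i\<phi> set_integral_add(1)[OF int iB]])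
    fix t
    have "p \<bullet> v t \<le> L (\<xi> t) (v t) + B"
      using legendre_ge_inner[OF p, of "v t" "\<xi> t"] by simp
    then have "\<phi> t * (p \<bullet> v t) \<le> \<phi> t * (L (\<xi> t) (v t) + B)"
      using \<phi>(2) by (simp add: mult_left_mono)
    also have "\<dots> \<le> L (\<xi> t) (v t) + B"
      using \<phi>(2,3)[of t] legendre_nonneg[of "\<xi> t" "v t"] \<open>B \<ge> 0\<close>
      by (intro mult_left_le_one_le) auto
    finally show "\<phi> t * (p \<bullet> v t) \<le> L (\<xi> t) (v t) + B" .
  qed
  also have "\<dots> = a + B * T"
    unfolding set_integral_add(2)[OF int iB] a
    using assms(1) by (simp add: set_lebesgue_integral_def)
  finally show "norm (x - y) \<le> a + B * T + \<delta>"
    using incr ends px by simp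
qed

text \<open>The new curves are \<open>\<xi> t + r t *\<^sub>R h\<close> and
  \<open>\<xi> t - r t *\<^sub>R h\<close>. Moving the positions back to \<open>\<xi> t\<close>
  costs \<open>C * norm h * \<bar>r t\<bar>\<close> for each; what remains is a second difference of
  \<open>L\<close> in the velocity.\<close>

lemma joins_perturb:
  assumes T: "T > 0" and j: "joins H T y x a"
    and r: "\<And>t. (r has_vector_derivative r' t) (at t)" "continuous_on UNIV r'"
    and I1: "(LINT t:{0<..<T}|lborel. \<bar>r t\<bar>) \<le> I1"
    and I2: "(LINT t:{0<..<T}|lborel. (r' t)\<^sup>2) \<le> I2"
  obtains a1 a2 where
    "joins H T (y + r 0 *\<^sub>R h) (x + r T *\<^sub>R h) a1" "joins H T (y - r 0 *\<^sub>R h) (x - r T *\<^sub>R h) a2"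
    "a1 + a2 \<le> 2 * a + 2 * C * norm h * I1 + (norm h)\<^sup>2 / c * I2"
proof -
  obtain \<xi> v where W: "W11 T \<xi> v" and ends: "\<xi> 0 = y" "\<xi> T = x"
    and int: "set_integrable lborel {0<..<T} (\<lambda>s. L (\<xi> s) (v s))"
    and a: "a = (LINT s:{0<..<T}|lborel. L (\<xi> s) (v s))"
    using j unfolding joins_def by auto
  have cr: "continuous_on UNIV r"
    by (intro continuous_at_imp_continuous_on ballI has_vector_derivative_continuous[OF r(1)])
  have C1: "W11 T (\<lambda>t. r t *\<^sub>R k) (\<lambda>t. r' t *\<^sub>R k)" for k :: "real^'n"
  proof (rule W11_C1)
    show "((\<lambda>t. r t *\<^sub>R k) has_vector_derivative r' t *\<^sub>R k) (at t)" for t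
      using r(1)[of t] by (auto intro!: derivative_eq_intros simp: has_real_derivative_iff_has_vector_derivative)
  qed (use T r(2) in \<open>auto intro!: continuous_intros\<close>)
  have W1: "W11 T (\<lambda>t. \<xi> t + r t *\<^sub>R h) (\<lambda>t. v t + r' t *\<^sub>R h)"
    by (rule W11_add[OF W C1])
  have W2: "W11 T (\<lambda>t. \<xi> t - r t *\<^sub>R h) (\<lambda>t. v t - r' t *\<^sub>R h)"
    using W11_add[OF W C1[of "- h"]] by simp
  define E1 where "E1 = (\<lambda>t. (2 * C * norm h) * \<bar>r t\<bar>)"
  define E2 where "E2 = (\<lambda>t. (norm h)\<^sup>2 / c * (r' t)\<^sup>2)"
  have iE: "set_integrable lborel {0<..<T} E1" "set_integrable lborel {0<..<T} E2"
    unfolding E1_def E2_def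
    by (intro set_integral_open_interval continuous_intros
        continuous_on_subset[OF cr] continuous_on_subset[OF r(2)] subset_UNIV)+
  define F where "F = (\<lambda>t. (2 * L (\<xi> t) (v t) + E1 t) + E2 t)"
  have iL: "set_integrable lborel {0<..<T} (\<lambda>t. 2 * L (\<xi> t) (v t))"
    using int by simp
  have iF: "set_integrable lborel {0<..<T} F"
    unfolding F_def by (intro set_integral_add iL iE)
  have pt: "L (\<xi> t + r t *\<^sub>R h) (v t + r' t *\<^sub>R h) + L (\<xi> t - r t *\<^sub>R h) (v t - r' t *\<^sub>R h) \<le> F t" for t
    using legendre_lipschitz[of "\<xi> t + r t *\<^sub>R h" "v t + r' t *\<^sub>R h" "\<xi> t"]
      legendre_lipschitz[of "\<xi> t - r t *\<^sub>R h" "v t - r' t *\<^sub>R h" "\<xi> t"]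
      legendre_second_difference[of "\<xi> t" "v t" "r' t *\<^sub>R h"]
    by (simp add: F_def E1_def E2_def power_mult_distrib mult.commute mult.left_commute)
  \<comment> \<open>Each Lagrangian is nonnegative, so the bound on their sum dominates each alone
    and gives its integrability.\<close>
  note L0 = legendre_nonneg
  have le1: "L (\<xi> t + r t *\<^sub>R h) (v t + r' t *\<^sub>R h) \<le> F t" for t
    using pt[of t] L0[of "\<xi> t - r t *\<^sub>R h" "v t - r' t *\<^sub>R h"] by linarith
  have le2: "L (\<xi> t - r t *\<^sub>R h) (v t - r' t *\<^sub>R h) \<le> F t" for t
    using pt[of t] L0[of "\<xi> t + r t *\<^sub>R h" "v t + r' t *\<^sub>R h"] by linarith
  note i1 = set_integrable_legendre[OF W1 iF le1]
  note i2 = set_integrable_legendre[OF W2 iF le2]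
  define a1 where "a1 = (LINT t:{0<..<T}|lborel. L (\<xi> t + r t *\<^sub>R h) (v t + r' t *\<^sub>R h))"
  define a2 where "a2 = (LINT t:{0<..<T}|lborel. L (\<xi> t - r t *\<^sub>R h) (v t - r' t *\<^sub>R h))"
  have "joins H T (y + r 0 *\<^sub>R h) (x + r T *\<^sub>R h) a1" "joins H T (y - r 0 *\<^sub>R h) (x - r T *\<^sub>R h) a2"
    unfolding joins_def using W1 W2 i1 i2 ends a1_def a2_def by blast+
  moreover have "a1 + a2 \<le> 2 * a + 2 * C * norm h * I1 + (norm h)\<^sup>2 / c * I2"
  proof -
    have "a1 + a2 \<le> (LINT t:{0<..<T}|lborel. F t)"
      unfolding a1_def a2_def set_integral_add(2)[OF i1 i2, symmetric]
      by (rule set_integral_mono[OF set_integral_add(1)[OF i1 i2] iF pt])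
    also have "\<dots> = 2 * a + 2 * C * norm h * (LINT t:{0<..<T}|lborel. \<bar>r t\<bar>)
        + (norm h)\<^sup>2 / c * (LINT t:{0<..<T}|lborel. (r' t)\<^sup>2)"
      unfolding F_def set_integral_add(2)[OF set_integral_add(1)[OF iL iE(1)] iE(2)]
        set_integral_add(2)[OF iL iE(1)]
      by (simp only: E1_def E2_def set_integral_mult_right a)
    also have "\<dots> \<le> 2 * a + 2 * C * norm h * I1 + (norm h)\<^sup>2 / c * I2"
      using C_nonneg c_pos by (intro add_mono mult_left_mono I1 I2) auto
    finally show ?thesis .
  qed
  ultimately show ?thesis
    using that by blast
qed

end

section \<open>Profiles that move one end of a curve\<close>

text \<open>A larger \<open>k\<close> shrinks the integral of the profile and raises that of its
  squared derivative. The latter is \<open>k\<^sup>2 / (T * (2 * k - 1))\<close>, and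
  \<open>k \<le> 2 * k - 1\<close>. The reversed versions serve to move the starting point.\<close>

lemma power_profile:
  fixes T :: real
  assumes T: "T > 0" and k: "k \<ge> 1"
  defines "r \<equiv> \<lambda>t. (t / T) ^ k" and "r' \<equiv> \<lambda>t. real k / T * (t / T) ^ (k - 1)"
  shows "(r has_vector_derivative r' t) (at t)"
    and "(LINT t:{0<..<T}|lborel. \<bar>r t\<bar>) \<le> T / k"
    and "(LINT t:{0<..<T}|lborel. (r' t)\<^sup>2) \<le> k / T"
    and "(LINT t:{0<..<T}|lborel. \<bar>r (T - t)\<bar>) \<le> T / k"
    and "(LINT t:{0<..<T}|lborel. (r' (T - t))\<^sup>2) \<le> k / T"
proof -
  have d: "((\<lambda>t. (t / T) ^ n) has_real_derivative real n / T * (t / T) ^ (n - 1)) (at t)" for n t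
    using T by (auto intro!: derivative_eq_intros)
  show "(r has_vector_derivative r' t) (at t)"
    using d[of k t] unfolding r_def r'_def by (simp add: has_real_derivative_iff_has_vector_derivative)
  have primitive: "((\<lambda>t. T / Suc n * (t / T) ^ Suc n) has_real_derivative (t / T) ^ n) (at t)" for n t
    using DERIV_cmult[OF d[of "Suc n" t], of "T / Suc n"] T by simp
  have primitive': "((\<lambda>t. - (T / Suc n * ((T - t) / T) ^ Suc n)) has_real_derivative ((T - t) / T) ^ n) (at t)" for n t
  proof -
    have "((\<lambda>t. T - t) has_real_derivative -1) (at t)"
      by (auto intro!: derivative_eq_intros)
    from DERIV_minus[OF DERIV_chain2[OF primitive this, of n]] show ?thesis by simp
  qed
  have P: "(LINT t:{0<..<T}|lborel. (t / T) ^ n) = T / Suc n" for n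
    using set_integral_derivative[of 0 T "\<lambda>t. T / Suc n * (t / T) ^ Suc n" "\<lambda>t. (t / T) ^ n"] T primitive[of n]
    by (simp add: has_real_derivative_iff_has_vector_derivative continuous_intros)
  have P': "(LINT t:{0<..<T}|lborel. ((T - t) / T) ^ n) = T / Suc n" for n
    using set_integral_derivative[of 0 T "\<lambda>t. - (T / Suc n * ((T - t) / T) ^ Suc n)" "\<lambda>t. ((T - t) / T) ^ n"] T primitive'[of n]
    by (simp add: has_real_derivative_iff_has_vector_derivative continuous_intros)
  have Sk: "T / Suc k \<le> T / k"
    using T k by (intro divide_left_mono) auto
  have "(LINT t:{0<..<T}|lborel. \<bar>r t\<bar>) = (LINT t:{0<..<T}|lborel. (t / T) ^ k)"
    by (rule set_lebesgue_integral_cong) (use T in \<open>auto simp: r_def\<close>)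
  then show "(LINT t:{0<..<T}|lborel. \<bar>r t\<bar>) \<le> T / k"
    using Sk P[of k] by simp
  have "(LINT t:{0<..<T}|lborel. \<bar>r (T - t)\<bar>) = (LINT t:{0<..<T}|lborel. ((T - t) / T) ^ k)"
    by (rule set_lebesgue_integral_cong) (use T in \<open>auto simp: r_def\<close>)
  then show "(LINT t:{0<..<T}|lborel. \<bar>r (T - t)\<bar>) \<le> T / k"
    using Sk P'[of k] by simp
  have sq: "(r' t)\<^sup>2 = (k / T)\<^sup>2 * (t / T) ^ (2 * (k - 1))" for t
    unfolding r'_def by (simp only: power_mult_distrib power_mult[symmetric] mult.commute[of 2])
  have "real k * real k \<le> real k * real (Suc (2 * (k - 1)))"
    using k by (intro mult_left_mono) auto
  then have E: "(k / T)\<^sup>2 * (T / Suc (2 * (k - 1))) \<le> k / T"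
  proof -
    define S where "S = real (Suc (2 * (k - 1)))"
    have "S > 0" by (simp add: S_def)
    have "(k / T)\<^sup>2 * (T / S) = (k * k) / (T * S)"
      using T by (simp add: power2_eq_square)
    also have "\<dots> \<le> (k * S) / (T * S)"
      using \<open>real k * real k \<le> _\<close> T \<open>S > 0\<close> by (intro divide_right_mono) (auto simp: S_def)
    also have "\<dots> = k / T"
      using \<open>S > 0\<close> by simp
    finally show ?thesis unfolding S_def .
  qed
  show "(LINT t:{0<..<T}|lborel. (r' t)\<^sup>2) \<le> k / T" "(LINT t:{0<..<T}|lborel. (r' (T - t))\<^sup>2) \<le> k / T"
    unfolding sq set_integral_mult_right P P' by (rule E)+
qed

text \<open>Take \<open>1 / sqrt d\<close> rounded up; as \<open>d \<le> 1\<close>, rounding at most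
  doubles it.\<close>

lemma balance_exponent:
  fixes d :: real
  assumes "0 < d" "d \<le> 1"
  obtains k :: nat where "k \<ge> 1" "1 / k \<le> sqrt d" "d * k \<le> 2 * sqrt d"
proof
  define k where "k = nat \<lceil>1 / sqrt d\<rceil>"
  have s: "0 < sqrt d" "sqrt d \<le> 1" "sqrt d * sqrt d = d"
    using assms by auto
  then have one: "1 \<le> 1 / sqrt d"
    by simp
  then have k: "1 / sqrt d \<le> k" "k \<le> 1 / sqrt d + 1"
    unfolding k_def by linarith+
  show "nat \<lceil>1 / sqrt d\<rceil> \<ge> 1" using one by linarith
  then show "1 / real (nat \<lceil>1 / sqrt d\<rceil>) \<le> sqrt d"
    using divide_left_mono[OF k(1), of 1] s(1) one unfolding k_def by simp
  have "2 / sqrt d = 1 / sqrt d + 1 / sqrt d"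
    by simp
  then have "d * k \<le> d * (2 / sqrt d)"
    using k(2) one assms by (intro mult_left_mono) linarith+
  also have "\<dots> = 2 * sqrt d"
    using s by (simp add: field_simps)
  finally show "d * real (nat \<lceil>1 / sqrt d\<rceil>) \<le> 2 * sqrt d"
    unfolding k_def .
qed

context tame_hamiltonian
begin

text \<open>The Lagrangian is only Lipschitz in the position, so moving a whole curve by \<open>h\<close> would give
  an error of order \<open>norm h\<close>.  The displacement \<open>(t / T) ^ k *\<^sub>R h\<close> is concentrated on a time interval
  of length \<open>T / k\<close>; with \<open>k\<close> of order \<open>1 / sqrt (norm h)\<close> the error becomes superlinear.\<close>

lemma joins_move:
  assumes T: "T > 0" and j: "joins H T y x a" and h: "norm h \<le> 1"
  defines "K \<equiv> 2 * C * T + 2 / (c * T)"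
  shows joins_move_end: "\<exists>a1 a2. joins H T y (x + h) a1 \<and> joins H T y (x - h) a2 \<and>
      a1 + a2 \<le> 2 * a + K * (norm h * sqrt (norm h))"
    and joins_move_start: "\<exists>a1 a2. joins H T (y + h) x a1 \<and> joins H T (y - h) x a2 \<and>
      a1 + a2 \<le> 2 * a + K * (norm h * sqrt (norm h))"
proof -
  have both: "(\<exists>a1 a2. joins H T y (x + h) a1 \<and> joins H T y (x - h) a2 \<and>
      a1 + a2 \<le> 2 * a + K * (norm h * sqrt (norm h))) \<and>
    (\<exists>a1 a2. joins H T (y + h) x a1 \<and> joins H T (y - h) x a2 \<and>
      a1 + a2 \<le> 2 * a + K * (norm h * sqrt (norm h)))"
  proof (cases "h = 0")
    case True
    then show ?thesis using j by force
  next
    case False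
    then obtain k :: nat where k: "k \<ge> 1" "1 / k \<le> sqrt (norm h)" "norm h * k \<le> 2 * sqrt (norm h)"
      using balance_exponent[of "norm h"] h by auto
    define r where "r = (\<lambda>t. (t / T) ^ k)"
    define r' where "r' = (\<lambda>t. real k / T * (t / T) ^ (k - 1))"
    have r: "(r has_vector_derivative r' t) (at t)"
      "(LINT t:{0<..<T}|lborel. \<bar>r t\<bar>) \<le> T / k"
      "(LINT t:{0<..<T}|lborel. (r' t)\<^sup>2) \<le> k / T"
      "(LINT t:{0<..<T}|lborel. \<bar>r (T - t)\<bar>) \<le> T / k"
      "(LINT t:{0<..<T}|lborel. (r' (T - t))\<^sup>2) \<le> k / T" for t
      unfolding r_def r'_def by (rule power_profile[OF T k(1)])+
    have cr': "continuous_on UNIV r'"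
      unfolding r'_def using T by (intro continuous_intros) auto
    \<comment> \<open>The reversed profile is \<open>1\<close> at time \<open>0\<close> and
      \<open>0\<close> at time \<open>T\<close>, so it moves the start and leaves the end
      fixed.\<close>
    have dr: "((\<lambda>t. r (T - t)) has_vector_derivative - r' (T - t)) (at t)" for t
    proof -
      have "((\<lambda>t. T - t) has_real_derivative -1) (at t)"
        by (auto intro!: derivative_eq_intros)
      from DERIV_chain2[OF r(1)[folded has_real_derivative_iff_has_vector_derivative] this]
      show ?thesis by (simp only: has_real_derivative_iff_has_vector_derivative mult_minus1_right)
    qed
    have cr: "continuous_on UNIV (\<lambda>t. - r' (T - t))"
      by (intro continuous_intros continuous_on_compose2[OF cr']) auto
    have [simp]: "r 0 = 0" "r T = 1"
      using T k(1) by (auto simp: r_def)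
    \<comment> \<open>By the choice of \<open>k\<close>, the position error gives the summand
      \<open>2 * C * T\<close> of \<open>K\<close> and the velocity error the summand
      \<open>2 / (c * T)\<close>.\<close>
    have "2 * C * norm h * (T / k) \<le> 2 * C * norm h * (T * sqrt (norm h))"
      using k(2) T C_nonneg by (intro mult_left_mono) (auto simp: divide_inverse)
    moreover have "(norm h)\<^sup>2 / c * (k / T) = (norm h / (c * T)) * (norm h * k)"
      by (simp add: power2_eq_square)
    moreover have "(norm h / (c * T)) * (norm h * k) \<le> (norm h / (c * T)) * (2 * sqrt (norm h))"
      using k(3) T c_pos by (intro mult_left_mono) auto
    moreover have "K * (norm h * sqrt (norm h)) = 2 * C * norm h * (T * sqrt (norm h))
        + (norm h / (c * T)) * (2 * sqrt (norm h))"
      unfolding K_def by (simp add: algebra_simps)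
    ultimately have K: "2 * a + 2 * C * norm h * (T / k) + (norm h)\<^sup>2 / c * (k / T)
        \<le> 2 * a + K * (norm h * sqrt (norm h))"
      by linarith
    obtain a1 a2 where "joins H T y (x + h) a1" "joins H T y (x - h) a2"
        "a1 + a2 \<le> 2 * a + 2 * C * norm h * (T / k) + (norm h)\<^sup>2 / c * (k / T)"
      using joins_perturb[OF T j r(1) cr' r(2,3), of h] by auto
    moreover obtain b1 b2 where "joins H T (y + h) x b1" "joins H T (y - h) x b2"
        "b1 + b2 \<le> 2 * a + 2 * C * norm h * (T / k) + (norm h)\<^sup>2 / c * (k / T)"
      using joins_perturb[OF T j dr cr r(4), of "k / T" h] r(5) by auto
    ultimately show ?thesis
      using K by (meson order_trans)
  qed
  from both show "\<exists>a1 a2. joins H T y (x + h) a1 \<and> joins H T y (x - h) a2 \<and>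
      a1 + a2 \<le> 2 * a + K * (norm h * sqrt (norm h))" by blast
  from both show "\<exists>a1 a2. joins H T (y + h) x a1 \<and> joins H T (y - h) x a2 \<and>
      a1 + a2 \<le> 2 * a + K * (norm h * sqrt (norm h))" by blast
qed

end

section \<open>Functions with one-sided second difference bounds\<close>

text \<open>The bound at \<open>y + h\<close> compares the increment over \<open>h\<close> with half
  of that over \<open>2 *\<^sub>R h\<close>. Starting from \<open>norm h \<ge> 1 / 2\<close>, where
  \<open>2 * M\<close> bounds the oscillation, the scale is halved repeatedly; the errors stay
  controlled because \<open>Q\<close> is superlinear. Exchanging the two points turns the lower
  bound into a Lipschitz bound.\<close>

lemma lipschitz_of_second_difference:
  fixes f :: "'a::real_normed_vector \<Rightarrow> real"
  assumes bound: "\<And>x. \<bar>f x\<bar> \<le> M" and "K \<ge> 0"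
    and diff2: "\<And>x h. norm h \<le> 1 \<Longrightarrow> f (x + h) + f (x - h) \<le> 2 * f x + K * (norm h * sqrt (norm h))"
  shows "(4 * M + 4 * K)-lipschitz_on UNIV f"
proof -
  have "M \<ge> 0" using bound[of undefined] by linarith
  define Q where "Q = (\<lambda>h::'a. norm h * sqrt (norm h))"
  have Q: "0 \<le> Q h" "norm h \<le> 1 \<Longrightarrow> Q h \<le> norm h" for h
    unfolding Q_def by (auto intro: mult_left_le)
  \<comment> \<open>The exact factor is \<open>2 * sqrt 2\<close>. The smaller \<open>5 / 2\<close>
    suffices: in the induction \<open>5 * K * Q h - K * Q h\<close> is exactly twice
    \<open>2 * K * Q h\<close>.\<close>
  have Q2: "2 * (5 / 4) * Q h \<le> Q (2 *\<^sub>R h)" for h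
  proof -
    have "5 / 4 \<le> sqrt 2" by (rule real_le_rsqrt) (simp add: power2_eq_square)
    then have "5 / 4 * (2 * Q h) \<le> sqrt 2 * (2 * Q h)"
      using Q(1) by (intro mult_right_mono) auto
    then show ?thesis unfolding Q_def by (simp add: real_sqrt_mult algebra_simps)
  qed
  define G where "G = (\<lambda>h. - (4 * M + 4 * K) * norm h + 2 * K * Q h)"
  have coarse: "G h \<le> f (y + h) - f y" if h: "norm h \<le> 1" "1 / 2 \<le> norm h" for y h
  proof -
    have "K * Q h \<le> K * norm h"
      using Q(2)[OF h(1)] \<open>K \<ge> 0\<close> by (intro mult_left_mono) auto
    then have "G h \<le> - (4 * M + 2 * K) * norm h"
      unfolding G_def by (simp add: algebra_simps)
    also have "\<dots> \<le> - (4 * M + 2 * K) * (1 / 2)"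
      using h \<open>M \<ge> 0\<close> \<open>K \<ge> 0\<close> by (intro mult_left_mono_neg) auto
    also have "\<dots> \<le> f (y + h) - f y"
      using bound[of y] bound[of "y + h"] \<open>K \<ge> 0\<close> by (auto simp: abs_le_iff)
    finally show ?thesis .
  qed
  \<comment> \<open>The term \<open>2 * K * Q h\<close> in \<open>G h\<close> absorbs the error made in passing from \<open>2 *\<^sub>R h\<close> to \<open>h\<close>.\<close>
  have claim: "G h \<le> f (y + h) - f y" if "norm h \<le> 1" "(1 / 2) ^ Suc n \<le> norm h" for n y h
    using that
  proof (induction n arbitrary: h)
    case 0
    then show ?case using coarse by simp
  next
    case (Suc n)
    show ?case
    proof (cases "norm h \<le> 1 / 2")
      case True
      have IH: "G (2 *\<^sub>R h) \<le> f (y + 2 *\<^sub>R h) - f y"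
        using Suc.IH[of "2 *\<^sub>R h"] Suc.prems(2) True by simp
      have "y + h + h = y + 2 *\<^sub>R h"
        by (simp only: scaleR_2 add.assoc)
      then have "f (y + 2 *\<^sub>R h) + f y \<le> 2 * f (y + h) + K * Q h"
        using diff2[of h "y + h"] Suc.prems(1) unfolding Q_def by (simp only: add_diff_cancel_right')
      moreover have "K * (2 * (5 / 4) * Q h) \<le> K * Q (2 *\<^sub>R h)"
        using Q2 \<open>K \<ge> 0\<close> by (rule mult_left_mono)
      ultimately show ?thesis
        using IH unfolding G_def by (simp add: algebra_simps)
    next
      case False
      then show ?thesis using coarse Suc.prems(1) by simp
    qed
  qed
  have lower: "- ((4 * M + 4 * K) * norm h) \<le> f (y + h) - f y" for y h
  proof -
    consider "h = 0" | "0 < norm h" "norm h \<le> 1" | "norm h > 1" by force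
    then show ?thesis
    proof cases
      case 2
      obtain n where "(1 / 2 :: real) ^ n < norm h"
        using real_arch_pow_inv[OF 2(1), of "1 / 2"] by auto
      moreover have "(1 / 2 :: real) ^ Suc n \<le> (1 / 2) ^ n" by simp
      ultimately have "(1 / 2 :: real) ^ Suc n \<le> norm h" by linarith
      from claim[OF 2(2) this, of y] show ?thesis
        using mult_nonneg_nonneg[OF \<open>K \<ge> 0\<close> Q(1)[of h]] unfolding G_def by (simp add: algebra_simps)
    next
      case 3
      have "M * 1 \<le> M * norm h" "0 \<le> K * norm h"
        using 3 \<open>M \<ge> 0\<close> \<open>K \<ge> 0\<close> by (intro mult_left_mono mult_nonneg_nonneg; simp)+
      then show ?thesis
        using bound[of y] bound[of "y + h"] by (simp add: abs_le_iff algebra_simps)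
    qed simp
  qed
  show ?thesis
  proof (rule lipschitz_onI)
    show "dist (f x) (f y) \<le> (4 * M + 4 * K) * dist x y" for x y
      using lower[of "x - y" y] lower[of "y - x" x]
      by (simp add: dist_norm norm_minus_commute abs_le_iff)
  qed (use \<open>M \<ge> 0\<close> \<open>K \<ge> 0\<close> in simp)
qed

section \<open>Uniform bounds from square integrals\<close>

lemma nn_integral_point_reflect:
  fixes F :: "'a::euclidean_space \<Rightarrow> ennreal"
  assumes [measurable]: "F \<in> borel_measurable borel" and s: "\<bar>s\<bar> = 1"
  shows "(\<integral>\<^sup>+ h. F (x + s *\<^sub>R h) \<partial>lborel) = (\<integral>\<^sup>+ y. F y \<partial>lborel)"
proof -
  have "s \<noteq> 0" using s by auto
  show ?thesis
    by (subst (2) lborel_affine[OF \<open>s \<noteq> 0\<close>, of x])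
      (simp add: s nn_integral_density nn_integral_distr)
qed

text \<open>A very large value of \<open>\<bar>f x\<bar>\<close> forces, for every \<open>h\<close>
  in the unit ball, \<open>f\<close> to be far from \<open>g\<close> at \<open>x + h\<close> or at
  \<open>x - h\<close>. Integrating over \<open>h\<close> then exceeds the budget
  \<open>B\<close>.\<close>

lemma bounded_of_second_difference_L2:
  fixes g :: "'a::euclidean_space \<Rightarrow> real"
  assumes g: "continuous_on UNIV g" "\<And>x. \<bar>g x\<bar> \<le> U" and "B \<ge> 0"
  obtains M where "\<And>f x. continuous_on UNIV f \<Longrightarrow>
    \<forall>x h. norm h \<le> 1 \<longrightarrow> f (x + h) + f (x - h) \<le> 2 * f x + K \<Longrightarrow>
    (\<integral>\<^sup>+ x. ennreal ((f x - g x)\<^sup>2) \<partial>lborel) \<le> ennreal B \<Longrightarrow> \<bar>f x\<bar> \<le> M"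
proof -
  define V where "V = measure lborel (ball (0::'a) 1)"
  have V: "V > 0" "emeasure lborel (ball (0::'a) 1) = ennreal V"
    unfolding V_def using content_ball_pos[of 1 "0::'a"] emeasure_lborel_ball_finite[of "0::'a" 1]
    by (simp_all add: emeasure_eq_ennreal_measure less_top[symmetric])
  \<comment> \<open>Chosen so that \<open>t * V\<close> exceeds \<open>2 * B\<close>;
    \<open>t \<ge> 1\<close> passes this on to \<open>t\<^sup>2 * V\<close> without a square
    root.\<close>
  define t where "t = 1 + 2 * B / V"
  have t: "t \<ge> 1" using V(1) \<open>B \<ge> 0\<close> by (simp add: t_def)
  have "2 * B < t * V" using V(1) by (simp add: t_def field_simps)
  also have "t * V \<le> t\<^sup>2 * V"
    using t V(1) by (intro mult_right_mono) (auto simp: power2_eq_square)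
  finally have tV: "2 * B < t\<^sup>2 * V" .
  \<comment> \<open>\<open>M1\<close> bounds \<open>f\<close> from below. The upper bound
    \<open>M2\<close> relies on it: with \<open>f (x + h + h) \<ge> - M1\<close>, a value of
    \<open>f x\<close> above \<open>M2\<close> pushes \<open>f (x + h)\<close> up to
    \<open>U + t\<close>.\<close>
  define M1 where "M1 = K / 2 + U + t"
  define M2 where "M2 = M1 + K + 2 * (U + t)"
  have "\<bar>f x\<bar> \<le> max M1 M2"
    if f: "continuous_on UNIV f"
      and diff2': "\<forall>x h. norm h \<le> 1 \<longrightarrow> f (x + h) + f (x - h) \<le> 2 * f x + K"
      and int: "(\<integral>\<^sup>+ x. ennreal ((f x - g x)\<^sup>2) \<partial>lborel) \<le> ennreal B" for f x
  proof -
    note diff2 = diff2'[rule_format]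
    define F where "F = (\<lambda>x. ennreal ((f x - g x)\<^sup>2))"
    have [measurable]: "f \<in> borel_measurable borel" "g \<in> borel_measurable borel"
      using f g(1) by (auto intro: borel_measurable_continuous_onI)
    have F[measurable]: "F \<in> borel_measurable borel"
      unfolding F_def by measurable
    \<comment> \<open>The translated and the reflected copy of \<open>F\<close> each have integral
      at most \<open>B\<close>, and \<open>2 * B < t\<^sup>2 * V\<close>.\<close>
    have no: "\<exists>h\<in>ball 0 1. \<not> ennreal (t\<^sup>2) \<le> F (x + h) + F (x - h)" for x
    proof (rule ccontr)
      assume "\<not> ?thesis"
      then have big: "ennreal (t\<^sup>2) * indicator (ball 0 1) h \<le> F (x + 1 *\<^sub>R h) + F (x + (-1) *\<^sub>R h)" for h
        by (auto simp: indicator_def)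
      have "ennreal (t\<^sup>2 * V) = (\<integral>\<^sup>+ h. ennreal (t\<^sup>2) * indicator (ball (0::'a) 1) h \<partial>lborel)"
        using V by (simp add: nn_integral_cmult_indicator ennreal_mult)
      also have "\<dots> \<le> (\<integral>\<^sup>+ h. F (x + 1 *\<^sub>R h) + F (x + (-1) *\<^sub>R h) \<partial>lborel)"
        by (rule nn_integral_mono) (rule big)
      also have "\<dots> = (\<integral>\<^sup>+ h. F (x + 1 *\<^sub>R h) \<partial>lborel) + (\<integral>\<^sup>+ h. F (x + (-1) *\<^sub>R h) \<partial>lborel)"
        by (rule nn_integral_add) auto
      also have "\<dots> = (\<integral>\<^sup>+ y. F y \<partial>lborel) + (\<integral>\<^sup>+ y. F y \<partial>lborel)"
        by (simp only: nn_integral_point_reflect[OF F] abs_one abs_minus_cancel)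
      also have "\<dots> \<le> ennreal B + ennreal B"
        unfolding F_def by (intro add_mono int)
      also have "\<dots> = ennreal (2 * B)"
        using \<open>B \<ge> 0\<close> by (simp flip: ennreal_plus)
      finally show False
        using tV \<open>B \<ge> 0\<close> by (simp add: ennreal_le_iff2)
    qed
    have F_big: "ennreal (t\<^sup>2) \<le> F z" if "\<bar>f z\<bar> \<ge> U + t" for z
    proof -
      have "\<bar>t\<bar> \<le> \<bar>f z - g z\<bar>"
        using that g(2)[of z] t by linarith
      then show ?thesis
        unfolding F_def by (intro ennreal_leI) (simp add: abs_le_square_iff)
    qed
    have low: "- M1 \<le> f x" for x
    proof (rule ccontr)
      assume "\<not> - M1 \<le> f x"
      then have "ennreal (t\<^sup>2) \<le> F (x + h) + F (x - h)" if "h \<in> ball 0 1" for h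
      proof -
        have "f (x + h) \<le> - (U + t) \<or> f (x - h) \<le> - (U + t)"
          using diff2[of h x] that \<open>\<not> - M1 \<le> f x\<close> unfolding M1_def by force
        then have "U + t \<le> \<bar>f (x + h)\<bar> \<or> U + t \<le> \<bar>f (x - h)\<bar>"
          by linarith
        then have "ennreal (t\<^sup>2) \<le> F (x + h) \<or> ennreal (t\<^sup>2) \<le> F (x - h)"
          using F_big by blast
        then show ?thesis
          by (meson add_increasing add_increasing2 zero_le)
      qed
      then show False using no by blast
    qed
    have "f x \<le> M2"
    proof (rule ccontr)
      assume "\<not> f x \<le> M2"
      then have "ennreal (t\<^sup>2) \<le> F (x + h) + F (x - h)" if "h \<in> ball 0 1" for h
      proof -
        have "f (x + h + h) + f x \<le> 2 * f (x + h) + K"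
          using diff2[of h "x + h"] that by simp
        then have "U + t \<le> f (x + h)"
          using low[of "x + h + h"] \<open>\<not> f x \<le> M2\<close> unfolding M2_def by argo
        then have "U + t \<le> \<bar>f (x + h)\<bar>"
          by (rule order_trans[OF _ abs_ge_self])
        then have "ennreal (t\<^sup>2) \<le> F (x + h)"
          by (rule F_big)
        then show ?thesis
          by (meson add_increasing2 zero_le)
      qed
      then show False using no by blast
    qed
    with low[of x] show ?thesis by linarith
  qed
  then show ?thesis using that by blast
qed

section \<open>Compactness for bounded Lipschitz families\<close>

lemma lipschitz_pointwise_imp_uniform:
  fixes w :: "nat \<Rightarrow> 'a::metric_space \<Rightarrow> real"
  assumes lip: "\<And>n. \<Lambda>-lipschitz_on UNIV (w n)" and lip0: "\<Lambda>-lipschitz_on UNIV w0"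
    and lim: "\<And>x. (\<lambda>n. w n x) \<longlonglongrightarrow> w0 x" and "compact S" and "e > 0"
  shows "\<forall>\<^sub>F n in sequentially. \<forall>y\<in>S. \<bar>w n y - w0 y\<bar> \<le> e"
proof -
  have "\<Lambda> \<ge> 0" using lip0 by (rule lipschitz_on_nonneg)
  \<comment> \<open>The \<open>1\<close> added to \<open>\<Lambda>\<close> covers the case
    \<open>\<Lambda> = 0\<close>.\<close>
  define d where "d = e / (3 * (\<Lambda> + 1))"
  have d: "d > 0" "\<Lambda> * d \<le> e / 3"
    using \<open>\<Lambda> \<ge> 0\<close> \<open>e > 0\<close> by (auto simp: d_def field_simps)
  obtain k where k: "finite k" "S \<subseteq> (\<Union>z\<in>k. ball z d)"
    using \<open>compact S\<close> d(1) unfolding compact_eq_totally_bounded by blast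
  have "\<forall>\<^sub>F n in sequentially. \<forall>z\<in>k. dist (w n z) (w0 z) < e / 3"
    using k(1) lim \<open>e > 0\<close> by (intro eventually_ball_finite ballI tendstoD) auto
  then show ?thesis
  proof (rule eventually_mono, safe)
    fix n y assume n: "\<forall>z\<in>k. dist (w n z) (w0 z) < e / 3" and "y \<in> S"
    then obtain z where z: "z \<in> k" "dist z y < d" using k(2) by auto
    have "\<Lambda> * dist z y \<le> \<Lambda> * d"
      using z \<open>\<Lambda> \<ge> 0\<close> by (intro mult_left_mono) auto
    then have "dist (w n z) (w n y) \<le> e / 3" and "dist (w0 z) (w0 y) \<le> e / 3"
      using lipschitz_onD[OF lip, of z y n] lipschitz_onD[OF lip0, of z y] d(2) by auto
    moreover have "dist (w n z) (w0 z) < e / 3"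
      using n z(1) by blast
    ultimately show "\<bar>w n y - w0 y\<bar> \<le> e"
      unfolding dist_real_def by argo
  qed
qed


text \<open>A diagonal subsequence converges on a countable dense set, and the common Lipschitz
  constant carries the Cauchy property to all other points.\<close>

lemma lipschitz_pointwise_subsequence:
  fixes w :: "nat \<Rightarrow> 'a::euclidean_space \<Rightarrow> real"
  assumes lip: "\<And>n. \<Lambda>-lipschitz_on UNIV (w n)" and bound: "\<And>n x. \<bar>w n x\<bar> \<le> M"
  obtains r w0 where "strict_mono (r :: nat \<Rightarrow> nat)" "\<And>x. (\<lambda>n. w (r n) x) \<longlonglongrightarrow> w0 x"
    "\<Lambda>-lipschitz_on UNIV w0" "\<And>x. \<bar>w0 x\<bar> \<le> M"
proof -
  have "\<Lambda> \<ge> 0" using lip by (rule lipschitz_on_nonneg)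
  obtain S :: "'a set" where S: "countable S" "\<And>U. open U \<Longrightarrow> U \<noteq> {} \<Longrightarrow> \<exists>q\<in>S. q \<in> U"
    using countable_dense_setE by blast
  obtain r where r: "strict_mono (r :: nat \<Rightarrow> nat)" "\<And>x. x \<in> S \<Longrightarrow> \<exists>l. (\<lambda>n. w (r n) x) \<longlonglongrightarrow> l"
    using function_convergent_subsequence[OF S(1), of w M] bound by auto
  have "Cauchy (\<lambda>n. w (r n) x)" for x
  proof (rule CauchyI)
    fix e :: real assume "e > 0"
    define d where "d = e / (3 * (\<Lambda> + 1))"
    have d: "d > 0" "\<Lambda> * d < e / 3"
      using \<open>\<Lambda> \<ge> 0\<close> \<open>e > 0\<close> by (auto simp: d_def field_simps)
    obtain q where q: "q \<in> S" "dist x q < d"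
      using S(2)[of "ball x d"] d(1) by auto
    have "Cauchy (\<lambda>n. w (r n) q)"
      using r(2)[OF q(1)] by (auto intro: LIMSEQ_imp_Cauchy)
    then obtain N where N: "\<And>m n. m \<ge> N \<Longrightarrow> n \<ge> N \<Longrightarrow> norm (w (r m) q - w (r n) q) < e / 3"
      using CauchyD[of _ "e / 3"] \<open>e > 0\<close> by force
    have "\<Lambda> * dist x q \<le> \<Lambda> * d"
      using q \<open>\<Lambda> \<ge> 0\<close> by (intro mult_left_mono) auto
    then have near: "\<bar>w (r n) x - w (r n) q\<bar> < e / 3" for n
      using lipschitz_onD[OF lip, of x q "r n"] d(2) by (auto simp: dist_real_def)
    show "\<exists>N. \<forall>m\<ge>N. \<forall>n\<ge>N. norm (w (r m) x - w (r n) x) < e"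
    proof (intro exI allI impI)
      fix m n assume "m \<ge> N" "n \<ge> N"
      from N[OF this] near[of m] near[of n] show "norm (w (r m) x - w (r n) x) < e"
        unfolding real_norm_def by argo
    qed
  qed
  then have "\<exists>l. (\<lambda>n. w (r n) x) \<longlonglongrightarrow> l" for x
    by (simp add: Cauchy_convergent_iff convergent_def)
  then obtain w0 where w0: "\<And>x. (\<lambda>n. w (r n) x) \<longlonglongrightarrow> w0 x"
    by metis
  have "\<Lambda>-lipschitz_on UNIV w0"
  proof (rule lipschitz_onI)
    show "dist (w0 x) (w0 y) \<le> \<Lambda> * dist x y" for x y
      using lipschitz_onD[OF lip] by (intro tendsto_upperbound[OF tendsto_dist[OF w0 w0]]) auto
  qed fact
  moreover have "\<bar>w0 x\<bar> \<le> M" for x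
    using bound by (intro tendsto_upperbound[OF tendsto_rabs[OF w0]]) auto
  ultimately show ?thesis using that r(1) w0 by blast
qed

section \<open>Membership in \<open>Lip0\<close>\<close>

lemma Lip0_I:
  assumes "L-lipschitz_on UNIV u" and "\<And>x. norm x > R \<Longrightarrow> u x = 0"
  shows "u \<in> Lip0"
proof -
  have "{x. u x \<noteq> 0} \<subseteq> cball 0 R"
    using assms(2) by (auto simp: not_less[symmetric])
  then have "compact (closure {x. u x \<noteq> 0})"
    by (meson bounded_cball bounded_closure bounded_subset closed_closure compact_eq_bounded_closed)
  with assms(1) show ?thesis by (auto simp: Lip0_def)
qed

lemma Lip0_E:
  assumes "u \<in> Lip0"
  obtains M R where "continuous_on UNIV u" "\<And>x. \<bar>u x\<bar> \<le> M" "M \<ge> 0" "\<And>x. norm x > R \<Longrightarrow> u x = 0"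
proof -
  obtain L where L: "L-lipschitz_on UNIV u" and c: "compact (closure {x. u x \<noteq> 0})"
    using assms by (auto simp: Lip0_def)
  have cont: "continuous_on UNIV u"
    using L by (rule lipschitz_on_continuous_on)
  have "compact (u ` closure {x. u x \<noteq> 0})"
    by (rule compact_continuous_image[OF continuous_on_subset[OF cont subset_UNIV] c])
  then obtain M where M: "\<And>x. x \<in> closure {x. u x \<noteq> 0} \<Longrightarrow> \<bar>u x\<bar> \<le> M"
    using compact_imp_bounded bounded_real by (metis imageI)
  have "\<bar>u x\<bar> \<le> max M 0" for x
    using M[of x] closure_subset[of "{x. u x \<noteq> 0}"] by (cases "u x = 0") (auto simp: le_max_iff_disj)
  moreover obtain R where "\<And>x. x \<in> closure {x. u x \<noteq> 0} \<Longrightarrow> norm x \<le> R"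
    using compact_imp_bounded[OF c] bounded_iff by blast
  then have "u x = 0" if "norm x > R" for x
    using that closure_subset[of "{x. u x \<noteq> 0}"] by force
  ultimately show ?thesis
    using that[of "max M 0" R] cont by auto
qed

section \<open>Inf-convolutions\<close>

text \<open>\<open>J\<close> may relate a pair of points to many costs, so this is the usual
  inf-convolution with the infimum of those costs.\<close>

definition inf_convolution :: "('a \<Rightarrow> 'a \<Rightarrow> real \<Rightarrow> bool) \<Rightarrow> ('a \<Rightarrow> real) \<Rightarrow> 'a \<Rightarrow> real" where
  "inf_convolution J u x = Inf {a + u y | y a. J y x a}"

text \<open>\<open>J y x a\<close> is read as: one can go from \<open>y\<close> to \<open>x\<close> at cost \<open>a\<close>.  The axioms are symmetric
  in the two points, so that statements about the forward operator carry over to the backward one.\<close>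

locale cost_relation =
  fixes J :: "real^'n \<Rightarrow> real^'n \<Rightarrow> real \<Rightarrow> bool" and K D :: real
  assumes K_nonneg: "K \<ge> 0"
    and J_refl: "J x x 0"
    and J_nonneg: "J y x a \<Longrightarrow> a \<ge> 0"
    and J_coercive: "J y x a \<Longrightarrow> norm (x - y) \<le> a + D"
    and J_move_end: "J y x a \<Longrightarrow> norm h \<le> 1 \<Longrightarrow> \<exists>a1 a2. J y (x + h) a1 \<and> J y (x - h) a2 \<and>
      a1 + a2 \<le> 2 * a + K * (norm h * sqrt (norm h))"
    and J_move_start: "J y x a \<Longrightarrow> norm h \<le> 1 \<Longrightarrow> \<exists>a1 a2. J (y + h) x a1 \<and> J (y - h) x a2 \<and>
      a1 + a2 \<le> 2 * a + K * (norm h * sqrt (norm h))"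
begin

lemma cost_relation_converse: "cost_relation (\<lambda>x y. J y x) K D"
proof
  show "norm (x - y) \<le> a + D" if "J x y a" for x y a
    using J_coercive[OF that] by (simp add: norm_minus_commute)
qed (use K_nonneg J_refl J_nonneg J_move_end J_move_start in blast)+

abbreviation "S \<equiv> inf_convolution J"

lemma S_le:
  assumes "bdd_below (range u)" "J y x a"
  shows "S u x \<le> a + u y"
  unfolding inf_convolution_def
proof (rule cInf_lower)
  obtain m where "\<And>y. m \<le> u y"
    using assms(1) unfolding bdd_below_def by auto
  then show "bdd_below {a + u y | y a. J y x a}"
    using J_nonneg by (intro bdd_belowI[of _ m]) (force intro: add_increasing)
qed (use assms(2) in blast)

text \<open>A real \<open>Inf\<close> is the greatest lower bound only of a nonempty set;
  \<open>J_refl\<close> supplies an element.\<close>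

lemma S_geI:
  assumes "\<And>y a. J y x a \<Longrightarrow> z \<le> a + u y"
  shows "z \<le> S u x"
  unfolding inf_convolution_def using J_refl[of x] assms by (intro cInf_greatest) auto

lemma S_le_self: "bdd_below (range u) \<Longrightarrow> S u x \<le> u x"
  using S_le[OF _ J_refl] by simp

lemma bdd_below_of_abs: "\<forall>y. \<bar>u y\<bar> \<le> M \<Longrightarrow> bdd_below (range u)" for u :: "real^'n \<Rightarrow> real"
  by (rule bdd_belowI2[of _ "- M"]) (simp add: abs_le_iff minus_le_iff)

lemma S_abs_le:
  assumes u: "\<forall>y. \<bar>u y\<bar> \<le> M"
  shows "\<forall>x. \<bar>S u x\<bar> \<le> M"
proof
  fix x
  have "- M \<le> a + u y" if "J y x a" for y a
    using J_nonneg[OF that] u[THEN spec, of y] by linarith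
  then have "- M \<le> S u x" by (rule S_geI)
  then show "\<bar>S u x\<bar> \<le> M"
    using S_le_self[OF bdd_below_of_abs[OF u], of x] u[THEN spec, of x] by linarith
qed

text \<open>Any route to \<open>x\<close> can be rerouted to \<open>x + h\<close> and to
  \<open>x - h\<close> from the same start, so the datum contributes \<open>2 * u y\<close> on both
  sides. This is why the modulus does not depend on \<open>u\<close>.\<close>

lemma S_second_difference:
  assumes u: "bdd_below (range u)" and h: "norm h \<le> 1"
  shows "S u (x + h) + S u (x - h) \<le> 2 * S u x + K * (norm h * sqrt (norm h))"
proof -
  have "(S u (x + h) + S u (x - h) - K * (norm h * sqrt (norm h))) / 2 \<le> S u x"
  proof (rule S_geI)
    fix y a assume "J y x a"
    then obtain a1 a2 where "J y (x + h) a1" "J y (x - h) a2"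
        "a1 + a2 \<le> 2 * a + K * (norm h * sqrt (norm h))"
      using J_move_end h by blast
    then show "(S u (x + h) + S u (x - h) - K * (norm h * sqrt (norm h))) / 2 \<le> a + u y"
      using S_le[OF u, of y "x + h" a1] S_le[OF u, of y "x - h" a2] by simp
  qed
  then show ?thesis by simp
qed

lemma S_lipschitz:
  assumes u: "\<forall>y. \<bar>u y\<bar> \<le> M"
  shows "(4 * M + 4 * K)-lipschitz_on UNIV (S u)"
  by (rule lipschitz_of_second_difference)
    (use S_abs_le[OF u] K_nonneg S_second_difference[OF bdd_below_of_abs[OF u]] in auto)

text \<open>Finite speed of propagation: a start farther away than \<open>2 * M + D\<close> costs
  more than \<open>2 * M\<close>, which is no better than staying at \<open>x\<close> for
  free.\<close>

lemma S_local_le: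
  assumes u: "\<forall>y. \<bar>u y\<bar> \<le> M" and u': "\<forall>y. \<bar>u' y\<bar> \<le> M" and "e \<ge> 0"
    and le: "\<And>y. norm (x - y) \<le> 2 * M + D \<Longrightarrow> u y \<le> u' y + e"
  shows "S u x \<le> S u' x + e"
proof -
  note low = bdd_below_of_abs[OF u]
  have "S u x - e \<le> S u' x"
  proof (rule S_geI)
    fix y a assume J: "J y x a"
    show "S u x - e \<le> a + u' y"
    proof (cases "norm (x - y) \<le> 2 * M + D")
      case True
      then show ?thesis using S_le[OF low J] le[of y] by linarith
    next
      case False
      then have "2 * M \<le> a" using J_coercive[OF J] by linarith
      then show ?thesis
        using S_le_self[OF low, of x] u[THEN spec, of x] u'[THEN spec, of y] \<open>e \<ge> 0\<close> by linarith
    qed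
  qed
  then show ?thesis by simp
qed

lemma S_local_eq:
  assumes "\<forall>y. \<bar>u y\<bar> \<le> M" "\<forall>y. \<bar>u' y\<bar> \<le> M"
    and "\<And>y. norm (x - y) \<le> 2 * M + D \<Longrightarrow> u y = u' y"
  shows "S u x = S u' x"
  using S_local_le[OF assms(1,2), of 0 x] S_local_le[OF assms(2,1), of 0 x] assms(3)
  by (intro antisym) auto

lemma S_tendsto:
  assumes lip: "\<And>n. \<Lambda>-lipschitz_on UNIV (w n)" "\<Lambda>-lipschitz_on UNIV w0"
    and bound: "\<And>n. \<forall>x. \<bar>w n x\<bar> \<le> M" "\<forall>x. \<bar>w0 x\<bar> \<le> M"
    and lim: "\<And>x. (\<lambda>n. w n x) \<longlonglongrightarrow> w0 x"
  shows "(\<lambda>n. S (w n) x) \<longlonglongrightarrow> S w0 x"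
proof (rule tendstoI)
  fix e :: real assume "e > 0"
  have "\<forall>\<^sub>F n in sequentially. \<forall>y\<in>cball x (2 * M + D). \<bar>w n y - w0 y\<bar> \<le> e / 2"
    using \<open>e > 0\<close> lim by (intro lipschitz_pointwise_imp_uniform[where w = w and \<Lambda> = \<Lambda>] lip) auto
  then show "\<forall>\<^sub>F n in sequentially. dist (S (w n) x) (S w0 x) < e"
  proof (rule eventually_mono)
    fix n assume n: "\<forall>y\<in>cball x (2 * M + D). \<bar>w n y - w0 y\<bar> \<le> e / 2"
    have near: "w n y \<le> w0 y + e / 2" "w0 y \<le> w n y + e / 2" if "norm (x - y) \<le> 2 * M + D" for y
    proof -
      have "\<bar>w n y - w0 y\<bar> \<le> e / 2"
        using bspec[OF n, of y] that by (simp add: dist_norm)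
      then show "w n y \<le> w0 y + e / 2" "w0 y \<le> w n y + e / 2" by argo+
    qed
    have "e / 2 \<ge> 0" using \<open>e > 0\<close> by simp
    have "S (w n) x \<le> S w0 x + e / 2"
      by (rule S_local_le[OF bound(1,2) \<open>e / 2 \<ge> 0\<close> near(1)])
    moreover have "S w0 x \<le> S (w n) x + e / 2"
      by (rule S_local_le[OF bound(2,1) \<open>e / 2 \<ge> 0\<close> near(2)])
    ultimately show "dist (S (w n) x) (S w0 x) < e"
      using \<open>e > 0\<close> unfolding dist_real_def by linarith
  qed
qed

text \<open>The witness is the backward operator applied to \<open>S u\<close>.\<close>

lemma regular_preimage:
  assumes u: "bdd_below (range u)" and Su: "\<forall>x. \<bar>S u x\<bar> \<le> M"
  obtains w where "(4 * M + 4 * K)-lipschitz_on UNIV w" "\<forall>y. \<bar>w y\<bar> \<le> M" "S w = S u"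
proof -
  interpret conv: cost_relation "\<lambda>x y. J y x" K D
    by (rule cost_relation_converse)
  define v where "v = (\<lambda>x. - S u x)"
  have v: "\<forall>x. \<bar>v x\<bar> \<le> M"
    using Su by (simp add: v_def)
  \<comment> \<open>Without the two signs, \<open>w y\<close> is the supremum of
    \<open>S u x - a\<close> over all routes from \<open>y\<close>. Below, \<open>ge\<close> yields
    \<open>S u \<le> S w\<close> and \<open>le\<close> yields \<open>S w \<le> S u\<close>.\<close>
  define w where "w = (\<lambda>y. - conv.S v y)"
  have wM: "\<forall>y. \<bar>w y\<bar> \<le> M"
    unfolding w_def using conv.S_abs_le[OF v] by simp
  have ge: "S u x - a \<le> w y" if "J y x a" for x y a
    unfolding w_def using conv.S_le[OF bdd_below_of_abs[OF v] that] by (simp add: v_def)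
  have le: "w y \<le> u y" for y
  proof -
    have "- u y \<le> conv.S v y"
    proof (rule conv.S_geI)
      show "- u y \<le> a + v x" if "J y x a" for x a
        using S_le[OF u that] by (simp add: v_def)
    qed
    then show ?thesis unfolding w_def by simp
  qed
  have "S w x = S u x" for x
  proof (rule antisym)
    show "S w x \<le> S u x"
    proof (rule S_geI)
      show "S w x \<le> a + u y" if "J y x a" for y a
        using S_le[OF bdd_below_of_abs[OF wM] that] le[of y] by linarith
    qed
    show "S u x \<le> S w x"
      using ge by (intro S_geI) (simp add: algebra_simps)
  qed
  moreover have "(4 * M + 4 * K)-lipschitz_on UNIV w"
    unfolding w_def using conv.S_lipschitz[OF v] by simp
  ultimately show ?thesis using that wM by blast
qed

text \<open>Capping by \<open>\<psi>\<close> first lowers \<open>S w\<close> at most to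
  \<open>min (S w x) 0\<close>. Raising to \<open>- \<kappa>\<close> acts only far out, where
  \<open>\<psi>\<close> is already \<open>0\<close>; there staying put gives
  \<open>S w2 x \<le> w2 x \<le> 0\<close>, so the raised value lies between \<open>S w1 x\<close>
  and \<open>0\<close>.\<close>

lemma truncation:
  assumes lip: "\<Lambda>-lipschitz_on UNIV w" and wM: "\<forall>y. \<bar>w y\<bar> \<le> M" and "M \<ge> 0"
  obtains w' where "w' \<in> Lip0" "\<And>x. norm x \<le> R \<Longrightarrow> S w' x = S w x"
    "\<And>x. norm x > R \<Longrightarrow> \<bar>S w' x\<bar> \<le> \<bar>S w x\<bar>"
proof -
  define \<rho> where "\<rho> = 2 * M + D"
  have "D \<ge> 0"
    using J_coercive[OF J_refl] by simp
  then have "\<rho> \<ge> 0" using \<open>M \<ge> 0\<close> by (simp add: \<rho>_def)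
  define cut where "cut = (\<lambda>r (y::real^'n). max 0 (min M (r + M - norm y)))"
  have cut: "0 \<le> cut r y" "cut r y \<le> M" "norm y \<le> r \<Longrightarrow> cut r y = M"
      "norm y \<ge> r + M \<Longrightarrow> cut r y = 0" for r y
    using \<open>M \<ge> 0\<close> by (auto simp: cut_def)
  have cut_lip: "\<bar>cut r y - cut r z\<bar> \<le> dist y z" for r y z
    using norm_triangle_ineq3[of y z] unfolding cut_def dist_norm by (auto simp: max_def min_def)
  \<comment> \<open>\<open>\<rho>\<close> is the reach of \<open>S\<close>, so plateau radius
    \<open>R + \<rho>\<close> preserves the values on the ball of radius \<open>R\<close>. Beyond
    \<open>R + \<rho> + M\<close> the cap is \<open>0\<close>; \<open>\<kappa>\<close> keeps its
    full height for one more reach.\<close>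
  define \<psi> where "\<psi> = cut (R + \<rho>)"
  define \<kappa> where "\<kappa> = cut (R + M + 2 * \<rho>)"
  define w1 where "w1 = (\<lambda>y. min (w y) (\<psi> y))"
  define w2 where "w2 = (\<lambda>y. max (w1 y) (- \<kappa> y))"
  have \<psi>: "0 \<le> \<psi> y" "\<psi> y \<le> M" and \<kappa>: "0 \<le> \<kappa> y" "\<kappa> y \<le> M" for y
    using cut by (auto simp: \<psi>_def \<kappa>_def)
  have w1M: "\<forall>y. \<bar>w1 y\<bar> \<le> M"
  proof
    show "\<bar>w1 y\<bar> \<le> M" for y
      using wM[THEN spec, of y] \<psi>[of y] by (simp add: w1_def abs_le_iff min_def)
  qed
  have w2M: "\<forall>y. \<bar>w2 y\<bar> \<le> M"
  proof
    show "\<bar>w2 y\<bar> \<le> M" for y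
      using w1M[THEN spec, of y] \<kappa>[of y] by (simp add: w2_def abs_le_iff max_def)
  qed
  note low = wM[THEN bdd_below_of_abs] w1M[THEN bdd_below_of_abs] w2M[THEN bdd_below_of_abs]
  have step1: "S w1 x \<le> S w x" "min (S w x) 0 \<le> S w1 x" for x
  proof -
    have "S w1 x \<le> a + w y" if "J y x a" for y a
      using S_le[OF low(2) that] by (simp add: w1_def)
    then show "S w1 x \<le> S w x" by (rule S_geI)
    show "min (S w x) 0 \<le> S w1 x"
    proof (rule S_geI)
      show "min (S w x) 0 \<le> a + w1 y" if "J y x a" for y a
        using S_le[OF low(1) that] J_nonneg[OF that] \<psi>[of y] by (auto simp: w1_def)
    qed
  qed
  have S12: "S w2 x = S w1 x" if "norm x \<le> R + M + \<rho>" for x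
  proof (rule S_local_eq[OF w2M w1M])
    fix y assume "norm (x - y) \<le> 2 * M + D"
    then have "norm y \<le> R + M + 2 * \<rho>"
      using that norm_triangle_ineq4[of x "x - y"] by (simp add: \<rho>_def)
    then show "w2 y = w1 y"
      using cut(3) w1M[THEN spec, of y] by (simp add: w2_def \<kappa>_def)
  qed
  have S01: "S w1 x = S w x" if "norm x \<le> R" for x
  proof (rule S_local_eq[OF w1M wM])
    fix y assume "norm (x - y) \<le> 2 * M + D"
    then have "norm y \<le> R + \<rho>"
      using that norm_triangle_ineq4[of x "x - y"] by (simp add: \<rho>_def)
    then show "w1 y = w y"
      using cut(3) wM[THEN spec, of y] by (simp add: w1_def \<psi>_def)
  qed
  have far: "\<bar>S w2 x\<bar> \<le> \<bar>S w1 x\<bar>" for x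
  proof (cases "norm x \<le> R + M + \<rho>")
    case True
    then show ?thesis using S12 by simp
  next
    case False
    then have "\<psi> x = 0" unfolding \<psi>_def by (intro cut(4)) simp
    then have "w2 x \<le> 0" using \<kappa>(1)[of x] by (simp add: w2_def w1_def)
    moreover have "S w2 x \<le> w2 x" by (rule S_le_self[OF low(3)])
    moreover have "S w1 x \<le> S w2 x"
    proof (rule S_geI)
      show "S w1 x \<le> a + w2 y" if "J y x a" for y a
        using S_le[OF low(2) that] by (simp add: w2_def)
    qed
    ultimately show ?thesis by simp
  qed
  have "\<Lambda> \<ge> 0" using lip by (rule lipschitz_on_nonneg)
  show ?thesis
  proof
    show "w2 \<in> Lip0"
    proof (rule Lip0_I)
      show "(max \<Lambda> 1)-lipschitz_on UNIV w2"
      proof (rule lipschitz_onI)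
        fix y z
        have "\<bar>w y - w z\<bar> \<le> \<Lambda> * dist y z"
          using lipschitz_onD[OF lip, of y z] by (simp add: dist_real_def)
        also have "\<dots> \<le> max \<Lambda> 1 * dist y z"
          by (intro mult_right_mono) auto
        finally have 1: "\<bar>w y - w z\<bar> \<le> max \<Lambda> 1 * dist y z" .
        have "dist y z \<le> max \<Lambda> 1 * dist y z"
          using mult_right_mono[of 1 "max \<Lambda> 1" "dist y z"] by simp
        then have 2: "\<bar>\<psi> y - \<psi> z\<bar> \<le> max \<Lambda> 1 * dist y z" "\<bar>\<kappa> y - \<kappa> z\<bar> \<le> max \<Lambda> 1 * dist y z"
          unfolding \<psi>_def \<kappa>_def using cut_lip order_trans by blast+
        show "dist (w2 y) (w2 z) \<le> max \<Lambda> 1 * dist y z"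
          using 1 2 unfolding w2_def w1_def dist_real_def by (auto simp: max_def min_def abs_le_iff)
      qed simp
      show "w2 y = 0" if "norm y > R + 2 * M + 2 * \<rho>" for y
      proof -
        have "\<psi> y = 0" "\<kappa> y = 0"
          unfolding \<psi>_def \<kappa>_def using that \<open>\<rho> \<ge> 0\<close> \<open>M \<ge> 0\<close> by (auto intro!: cut(4))
        then show ?thesis by (simp add: w2_def w1_def)
      qed
    qed
    show "S w2 x = S w x" if "norm x \<le> R" for x
      using S12[of x] S01[of x] that \<open>\<rho> \<ge> 0\<close> \<open>M \<ge> 0\<close> by simp
    show "\<bar>S w2 x\<bar> \<le> \<bar>S w x\<bar>" for x
    proof -
      have "\<bar>S w1 x\<bar> \<le> \<bar>S w x\<bar>"
        using step1[of x] by (auto simp: min_def split: if_splits)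
      then show ?thesis using far[of x] by linarith
    qed
  qed
qed

section \<open>Existence of a minimizer\<close>

theorem minimizer_exists:
  assumes "g \<in> Lip0"
  shows "\<exists>u\<in>Lip0. \<forall>u'\<in>Lip0. L2_norm_sq (\<lambda>x. S u x - g x) \<le> L2_norm_sq (\<lambda>x. S u' x - g x)"
proof -
  define E where "E = (\<lambda>u. L2_norm_sq (\<lambda>x. S u x - g x))"
  define m where "m = (INF u\<in>Lip0. E u)"
  obtain U R where g: "continuous_on UNIV g" "\<And>x. \<bar>g x\<bar> \<le> U" "\<And>x. norm x > R \<Longrightarrow> g x = 0"
    by (rule Lip0_E[OF assms]) (rule that)
  have "\<exists>u\<in>Lip0. E u \<le> m"
  proof (cases "m = \<infinity>")
    case True
    have "(\<lambda>_. 0) \<in> Lip0"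
      by (rule Lip0_I[of 0 _ 0]) (auto intro: lipschitz_onI)
    then show ?thesis using True by auto
  next
    case False
    have "\<exists>u\<in>Lip0. E u < m + ennreal (1 / Suc n)" for n
      by (rule INF_approx_ennreal) (use False m_def in auto)
    then obtain u where u: "\<And>n. u n \<in> Lip0" "\<And>n. E (u n) < m + ennreal (1 / Suc n)"
      by metis
    define B where "B = enn2real m + 1"
    have B: "B \<ge> 0" "E (u n) \<le> ennreal B" for n
    proof -
      have "m + ennreal (1 / Suc n) \<le> m + ennreal 1"
        by (intro add_left_mono ennreal_leI) simp
      also have "\<dots> = ennreal B"
        using False unfolding B_def by (subst ennreal_plus) (auto simp: less_top)
      finally show "E (u n) \<le> ennreal B" using u(2)[of n] by simp
    qed (simp add: B_def)
    \<comment> \<open>\<open>M0\<close> is fixed before any \<open>f\<close> is given, so one bound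
      serves the whole minimizing sequence.\<close>
    obtain M0 where M0: "\<And>f x. continuous_on UNIV f \<Longrightarrow>
        \<forall>x h. norm h \<le> 1 \<longrightarrow> f (x + h) + f (x - h) \<le> 2 * f x + K \<Longrightarrow>
        (\<integral>\<^sup>+ x. ennreal ((f x - g x)\<^sup>2) \<partial>lborel) \<le> ennreal B \<Longrightarrow> \<bar>f x\<bar> \<le> M0"
      by (rule bounded_of_second_difference_L2[OF g(1,2) B(1), of K]) blast
    define M where "M = max M0 0"
    have u_bounded: "\<exists>Mn. \<forall>x. \<bar>u n x\<bar> \<le> Mn" for n
      by (rule Lip0_E[OF u(1)]) blast
    have u_low: "bdd_below (range (u n))" for n
      by (rule exE[OF u_bounded[of n]]) (rule bdd_below_of_abs)
    have Su: "\<forall>x. \<bar>S (u n) x\<bar> \<le> M" for n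
    proof
      fix x
      obtain Mn where Mn: "\<forall>x. \<bar>u n x\<bar> \<le> Mn"
        using u_bounded[of n] by blast
      have "\<bar>S (u n) x\<bar> \<le> M0"
      proof (rule M0)
        show "continuous_on UNIV (S (u n))"
          using S_lipschitz[OF Mn] by (rule lipschitz_on_continuous_on)
        show "\<forall>x h. norm h \<le> 1 \<longrightarrow> S (u n) (x + h) + S (u n) (x - h) \<le> 2 * S (u n) x + K"
        proof (intro allI impI)
          fix x h :: "real^'n" assume h: "norm h \<le> 1"
          have "K * (norm h * sqrt (norm h)) \<le> K * 1"
            using h K_nonneg by (intro mult_left_mono mult_le_one) auto
          then show "S (u n) (x + h) + S (u n) (x - h) \<le> 2 * S (u n) x + K"
            using S_second_difference[OF u_low h, of n x] by linarith
        qed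
        show "(\<integral>\<^sup>+ x. ennreal ((S (u n) x - g x)\<^sup>2) \<partial>lborel) \<le> ennreal B"
          using B(2)[of n] by (simp add: E_def L2_norm_sq_def)
      qed
      then show "\<bar>S (u n) x\<bar> \<le> M" by (simp add: M_def)
    qed
    have "\<exists>w. (4 * M + 4 * K)-lipschitz_on UNIV w \<and> (\<forall>y. \<bar>w y\<bar> \<le> M) \<and> S w = S (u n)" for n
      by (rule regular_preimage[OF u_low Su]) blast
    then obtain w where w: "\<And>n. (4 * M + 4 * K)-lipschitz_on UNIV (w n)"
        "\<And>n. \<forall>y. \<bar>w n y\<bar> \<le> M" "\<And>n. S (w n) = S (u n)"
      by metis
    obtain r w0 where r: "strict_mono (r :: nat \<Rightarrow> nat)" "\<And>x. (\<lambda>n. w (r n) x) \<longlonglongrightarrow> w0 x"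
        and w0: "(4 * M + 4 * K)-lipschitz_on UNIV w0" "\<forall>x. \<bar>w0 x\<bar> \<le> M"
      by (rule lipschitz_pointwise_subsequence[of "4 * M + 4 * K" w M]) (use w in auto)
    have lim: "(\<lambda>n. S (w (r n)) x) \<longlonglongrightarrow> S w0 x" for x
      by (rule S_tendsto[where w = "\<lambda>n. w (r n)"]) (rule w w0 r)+
    have meas: "S (w n) \<in> borel_measurable borel" for n
      by (intro borel_measurable_continuous_onI lipschitz_on_continuous_on[OF S_lipschitz[OF w(2)]])
    have [measurable]: "g \<in> borel_measurable borel"
      using g(1) by (rule borel_measurable_continuous_onI)
    \<comment> \<open>Fatou's lemma: the integrands converge pointwise, and \<open>w (r n)\<close>
      has the same cost as \<open>u (r n)\<close>.\<close>
    have "E w0 = (\<integral>\<^sup>+ x. liminf (\<lambda>n. ennreal ((S (w (r n)) x - g x)\<^sup>2)) \<partial>lborel)"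
      unfolding E_def L2_norm_sq_def
      by (intro nn_integral_cong lim_imp_Liminf[symmetric] tendsto_ennrealI tendsto_intros lim) auto
    also have "\<dots> \<le> liminf (\<lambda>n. E (w (r n)))"
      unfolding E_def L2_norm_sq_def
      by (rule nn_integral_liminf) (use meas in measurable)
    also have "\<dots> \<le> liminf (\<lambda>n. m + ennreal (1 / Suc (r n)))"
      using u(2) w(3) by (intro Liminf_mono always_eventually) (auto simp: E_def less_imp_le)
    also have "\<dots> = m"
    proof (rule lim_imp_Liminf)
      have "(\<lambda>n. 1 / real (Suc (r n))) \<longlonglongrightarrow> 0"
        using LIMSEQ_subseq_LIMSEQ[OF LIMSEQ_inverse_real_of_nat r(1)]
        by (simp add: o_def inverse_eq_divide)
      then have "(\<lambda>n. ennreal (1 / Suc (r n))) \<longlonglongrightarrow> ennreal 0"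
        by (rule tendsto_ennrealI)
      from tendsto_add[OF tendsto_const this, of m]
      show "(\<lambda>n. m + ennreal (1 / Suc (r n))) \<longlonglongrightarrow> m" by simp
    qed simp
    finally have Ew0: "E w0 \<le> m" .
    obtain w' where w': "w' \<in> Lip0" "\<And>x. norm x \<le> R \<Longrightarrow> S w' x = S w0 x"
        "\<And>x. norm x > R \<Longrightarrow> \<bar>S w' x\<bar> \<le> \<bar>S w0 x\<bar>"
      by (rule truncation[OF w0, of R]) (auto simp: M_def)
    \<comment> \<open>Inside radius \<open>R\<close> nothing changes; outside, \<open>g\<close>
      vanishes and the integrand is the square of a value that has not grown in absolute
      value.\<close>
    have "E w' \<le> E w0"
      unfolding E_def L2_norm_sq_def
    proof (intro nn_integral_mono ennreal_leI)
      show "(S w' x - g x)\<^sup>2 \<le> (S w0 x - g x)\<^sup>2" for x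
        using w'(2,3)[of x] g(3)[of x] by (cases "norm x \<le> R") (auto simp: abs_le_square_iff)
    qed
    then have "E w' \<le> m" using Ew0 by (rule order_trans)
    then show ?thesis using w'(1) by blast
  qed
  then show ?thesis
    unfolding m_def E_def by (meson INF_lower order_trans)
qed

end

theorem theorem8:
  fixes H :: "real^'n \<Rightarrow> real^'n \<Rightarrow> real" and T :: real and uT :: "real^'n \<Rightarrow> real"
  assumes T: "T > 0"
    and H1: "C2 (\<lambda>(x, p). H x p)"
      "\<exists>c0>0. \<forall>x p. loewner_le (c0 *\<^sub>R mat 1) (H_pp H x p)"
    and H2: "\<forall>x p. H x p \<ge> 0" "\<forall>x. H x 0 \<le> 0"
    and H3: "\<exists>C>0. \<forall>x p. norm (H_x H x p) \<le> C"
    and H4: "\<forall>R>0. \<exists>C>0. \<forall>x p. norm p \<le> R \<longrightarrow> norm (H_p H x p) \<le> C"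
    and uT: "uT \<in> Lip0"
  shows "\<exists>u0_opt\<in>Lip0. \<forall>u0\<in>Lip0. J_T H T uT u0_opt \<le> J_T H T uT u0"
proof -
  obtain c where c: "c > 0" "\<And>x p. loewner_le (c *\<^sub>R mat 1) (H_pp H x p)"
    using H1(2) by blast
  obtain C where C: "\<And>x p. norm (H_x H x p) \<le> C"
    using H3 by blast
  obtain B where B: "\<And>x p. norm p \<le> 1 \<Longrightarrow> norm (H_p H x p) \<le> B"
    using H4[rule_format, of 1] by auto
  have H_0: "H x 0 = 0" for x
    using H2 by (simp add: antisym)
  have "tame_hamiltonian H c C B"
  proof
    show "\<bar>H x p - H y p\<bar> \<le> C * norm (x - y)" for x y p
      using lipschitz_of_grad_bound[of "\<lambda>y. H y p"] gderiv_H_x[OF H1(1)] C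
      by (simp add: H_x_def)
    show "H x p \<le> B" if p: "norm p \<le> 1" for x p
      using H_le_of_grad_bound[OF H1(1) B H_0 p] .
  qed (use c H2 H_0 continuous_H[OF H1(1)] H_midpoint[OF H1(1) c(2)] in auto)
  then interpret tame_hamiltonian H c C B .
  define K where "K = 2 * C * T + 2 / (c * T)"
  interpret cost_relation "joins H T" K "B * T"
  proof
    show "K \<ge> 0"
      using C_nonneg c_pos T by (simp add: K_def)
    show "joins H T x x 0" for x
      using T by (rule joins_refl)
    show "norm (x - y) \<le> a + B * T" if "joins H T y x a" for x y a
      using T that by (rule joins_coercive)
  qed (use joins_nonneg joins_move[OF T] in \<open>auto simp: K_def\<close>)
  \<comment> \<open>Both infima run over the same set: a curve of \<open>S_plus\<close> joins its
    own starting point \<open>\<xi> 0\<close> to \<open>x\<close>.\<close>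
  have "S_plus H T u = S u" for u
    unfolding S_plus_def inf_convolution_def joins_def fun_eq_iff
    by (intro allI arg_cong[where f = Inf]) blast
  then show ?thesis
    using minimizer_exists[OF uT] unfolding J_T_def by simp
qed

end
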